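(* Let $P$ be a set of $n$ points in $\mathbb{R}^d$ and let $L$ be a set of lines so that each line contains at least $r$ points of $P$. There are constants $K$ and $N$, dependent only on $d$, so that if $$|L|\ \ge\ K\,\frac{n^2}{r^{d+1}},$$ then there exists a hyperplane containing $N\,\frac{n}{r^{d-1}}$ points of $P$.
   Context: Lines are affine lines in $\mathbb{R}^d$, $|L|$ denotes the number of lines in $L$, and a hyperplane is a $(d-1)$-dimensional affine subspace of $\mathbb{R}^d$.
   Formalization: The formal theorem requires r to be an integer with r ≥ 2; for r = 1 the claim fails (arbitrarily many lines pass through points in general position, yet no hyperplane contains more than d of them), and for r = 0 the bound is undefined. *)

theory Defs
  imports "HOL-Analysis.Analysis"
begin

definition affine_line :: "(real ^ 'd) set \<Rightarrow> bool" where
  "affine_line l \<longleftrightarrow> affine l \<and> aff_dim l = 1"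

definition hyperplane :: "(real ^ 'd) set \<Rightarrow> bool" where
  "hyperplane H \<longleftrightarrow> affine H \<and> aff_dim H = int CARD('d) - 1"

end

theory Submission
  imports Defs "HOL-Homology.Invariance_of_Domain"
begin

text \<open>
  Polynomial partitioning yields a nonzero polynomial \<open>F\<close> of degree at most \<open>r / 8\<close> and about \<open>r ^ d\<close>
  cells, each containing \<open>O(n / r ^ d)\<close> points off the zero set of \<open>F\<close>.  A line on which \<open>F\<close> does not
  vanish meets at most \<open>deg F + 1\<close> cells, hence determines at least \<open>r / 4\<close> pairs of its points lying in
  a common cell; as there are only \<open>O(n\<^sup>2 / r ^ d)\<close> such pairs, there are \<open>O(n\<^sup>2 / r ^ (d + 1))\<close> such lines.
  So \<open>F\<close> vanishes on at least half of the lines.  Pass to a subconfiguration in which every line is still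
  rich and every point lies on many lines, and take a nonzero polynomial of least degree vanishing on its
  lines.  Its gradient is nonzero at some point of the subconfiguration, and all the lines through that
  point lie in the hyperplane orthogonal to the gradient.

  The partition comes from bisecting finite point sets by polynomials, which needs the Borsuk--Ulam theorem
  only for Lipschitz maps that are homogeneous of degree one.  For these the oddness of the degree follows
  from the mod-2 step on equators, since by lattice point counting the image of the equator misses a line.
\<close>

section \<open>Borsuk--Ulam for homogeneous Lipschitz maps\<close>

definition norm1 :: "nat \<Rightarrow> (nat \<Rightarrow> real) \<Rightarrow> real" where
  "norm1 m x = (\<Sum>j\<le>m. \<bar>x j\<bar>)"

text \<open>Only the coordinates up to \<open>m\<close> enter the Lipschitz bound, so
  \<open>G x\<close> depends on these alone. Homogeneity for every real \<open>t\<close>, negative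
  ones included, makes \<open>G\<close> odd.\<close>

definition lip_hom :: "nat \<Rightarrow> real \<Rightarrow> ((nat \<Rightarrow> real) \<Rightarrow> nat \<Rightarrow> real) \<Rightarrow> bool" where
  "lip_hom m C G \<longleftrightarrow>
    (\<forall>x y i. \<bar>G x i - G y i\<bar> \<le> C * norm1 m (\<lambda>j. x j - y j)) \<and>
    (\<forall>t x i. G (\<lambda>j. t * x j) i = t * G x i)"

text \<open>Coordinates beyond \<open>m\<close> become 0 because the points of
  \<open>nsphere m\<close> are sequences vanishing there.\<close>

definition normalize_to :: "nat \<Rightarrow> (nat \<Rightarrow> real) \<Rightarrow> nat \<Rightarrow> real" where
  "normalize_to m y = (\<lambda>i. if i \<le> m then y i / sqrt (\<Sum>j\<le>m. (y j)\<^sup>2) else 0)"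

lemma norm1_nonneg: "0 \<le> norm1 m x"
  by (simp add: norm1_def sum_nonneg)

lemma norm1_scale: "norm1 m (\<lambda>j. t * x j) = \<bar>t\<bar> * norm1 m x"
  by (simp add: norm1_def abs_mult sum_distrib_left)

lemma abs_le_norm1: "i \<le> m \<Longrightarrow> \<bar>x i\<bar> \<le> norm1 m x"
  unfolding norm1_def by (rule member_le_sum) auto

lemma norm1_eq_0_iff: "norm1 m x = 0 \<longleftrightarrow> (\<forall>i\<le>m. x i = 0)"
  by (auto simp: norm1_def sum_nonneg_eq_0_iff)

lemma lip_homD:
  assumes "lip_hom m C G"
  shows "\<bar>G x i - G y i\<bar> \<le> C * norm1 m (\<lambda>j. x j - y j)"
    and "G (\<lambda>j. t * x j) i = t * G x i"
  using assms by (auto simp: lip_hom_def)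

lemma lip_hom_uminus: "lip_hom m C G \<Longrightarrow> G (\<lambda>j. - x j) i = - G x i"
  using lip_homD(2)[of m C G "-1" x i] by simp

lemma lip_hom_tendsto:
  assumes "lip_hom m C G" and "\<And>j. j \<le> m \<Longrightarrow> ((\<lambda>n. x n j) \<longlongrightarrow> l j) F"
  shows "((\<lambda>n. G (x n) i) \<longlongrightarrow> G l i) F"
proof -
  have "((\<lambda>n. C * norm1 m (\<lambda>j. x n j - l j)) \<longlongrightarrow> C * (\<Sum>j\<le>m. \<bar>l j - l j\<bar>)) F"
    unfolding norm1_def by (intro tendsto_intros assms) auto
  then have "((\<lambda>n. C * norm1 m (\<lambda>j. x n j - l j)) \<longlongrightarrow> 0) F" by simp
  then have "((\<lambda>n. G (x n) i - G l i) \<longlongrightarrow> 0) F"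
    by (rule Lim_null_comparison[rotated]) (auto simp: lip_homD(1)[OF assms(1)])
  then show ?thesis by (rule LIM_zero_cancel)
qed

lemma lip_hom_continuous_on:
  assumes "lip_hom m C G"
  shows "continuous_on S (\<lambda>x. G x i)"
proof -
  have "((\<lambda>x. x j) \<longlongrightarrow> a j) (at a within S)" for a :: "nat \<Rightarrow> real" and j
  proof (rule tendsto_within_subset[OF _ subset_UNIV])
    show "((\<lambda>x. x j) \<longlongrightarrow> a j) (at a within UNIV)"
      using continuous_on_product_coordinates[of j, unfolded continuous_on_def] by (rule bspec) simp
  qed
  then show ?thesis
    unfolding continuous_on_def by (intro ballI lip_hom_tendsto[OF assms])
qed

lemma bounded_coordinates_convergent_subseq:
  fixes f :: "nat \<Rightarrow> nat \<Rightarrow> real"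
  assumes "\<And>n i. i \<le> m \<Longrightarrow> \<bar>f n i\<bar> \<le> B"
  obtains l and \<rho> :: "nat \<Rightarrow> nat" where "strict_mono \<rho>" "\<And>i. i \<le> m \<Longrightarrow> (\<lambda>n. f (\<rho> n) i) \<longlonglongrightarrow> l i"
proof -
  have "\<forall>d\<subseteq>{..m}. \<exists>l::nat \<Rightarrow> real. \<exists>\<rho>::nat\<Rightarrow>nat. strict_mono \<rho> \<and>
     (\<forall>e>0. eventually (\<lambda>n. \<forall>i\<in>d. dist (f (\<rho> n) i) (l i) < e) sequentially)"
    by (rule compact_lemma_general[where unproj="\<lambda>x. x" and proj="\<lambda>x. x"])
       (use assms in \<open>auto simp: bounded_iff\<close>)
  then obtain l \<rho> where \<rho>: "strict_mono (\<rho>::nat\<Rightarrow>nat)"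
    and ev: "\<And>e. e > 0 \<Longrightarrow> eventually (\<lambda>n. \<forall>i\<in>{..m}. dist (f (\<rho> n) i) (l i) < e) sequentially"
    by blast
  show ?thesis
  proof (rule that[OF \<rho>])
    show "(\<lambda>n. f (\<rho> n) i) \<longlonglongrightarrow> l i" if "i \<le> m" for i
      using that by (intro tendstoI) (auto elim!: eventually_mono[OF ev])
  qed
qed

text \<open>Compactness: otherwise homogeneity gives points of norm 1 whose images tend to 0, and
  the limit of a convergent subsequence is a zero of \<open>G\<close> of norm 1.\<close>

lemma lip_hom_lower_bound:
  assumes G: "lip_hom m C G" and nz: "\<And>x. \<forall>i\<le>k. G x i = 0 \<Longrightarrow> \<forall>j\<le>m. x j = 0"
  obtains c where "c > 0" "\<And>x. c * norm1 m x \<le> norm1 k (G x)"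
proof -
  have "\<exists>c>0. \<forall>x. c * norm1 m x \<le> norm1 k (G x)"
  proof (rule ccontr)
    assume *: "\<not> ?thesis"
    have "\<exists>x. norm1 m x = 1 \<and> norm1 k (G x) < inverse (real (Suc n))" for n
    proof -
      have "inverse (real (Suc n)) > 0" by simp
      then obtain x where x: "norm1 k (G x) < inverse (real (Suc n)) * norm1 m x"
        using * by (meson not_le)
      then have "norm1 m x \<noteq> 0" using norm1_nonneg[of k "G x"] by auto
      then have pos: "norm1 m x > 0" using norm1_nonneg[of m x] by linarith
      let ?y = "\<lambda>j. inverse (norm1 m x) * x j"
      have "G ?y = (\<lambda>i. inverse (norm1 m x) * G x i)"
        using lip_homD(2)[OF G] by auto
      then have "norm1 m ?y = 1" "norm1 k (G ?y) < inverse (real (Suc n))"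
        using pos x by (simp_all only: norm1_scale) (simp_all add: field_simps)
      then show ?thesis by blast
    qed
    then obtain X where X: "\<And>n. norm1 m (X n) = 1" "\<And>n. norm1 k (G (X n)) < inverse (real (Suc n))"
      by metis
    obtain l \<rho> where \<rho>: "strict_mono \<rho>" and l: "\<And>i. i \<le> m \<Longrightarrow> (\<lambda>n. X (\<rho> n) i) \<longlonglongrightarrow> l i"
      using bounded_coordinates_convergent_subseq[of m X 1] X(1) abs_le_norm1 by metis
    have "(\<lambda>n. norm1 m (X (\<rho> n))) \<longlonglongrightarrow> norm1 m l"
      unfolding norm1_def by (intro tendsto_intros l) auto
    then have l1: "norm1 m l = 1" using X(1) by (simp add: LIMSEQ_const_iff)
    have a: "(\<lambda>n. norm1 k (G (X (\<rho> n)))) \<longlonglongrightarrow> norm1 k (G l)"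
      unfolding norm1_def by (intro tendsto_intros lip_hom_tendsto[OF G] l) auto
    have b: "(\<lambda>n. norm1 k (G (X n))) \<longlonglongrightarrow> 0"
      by (rule Lim_null_comparison[OF _ LIMSEQ_inverse_real_of_nat])
         (use X(2) in \<open>auto intro!: eventuallyI less_imp_le simp: norm1_nonneg simp del: of_nat_Suc\<close>)
    from LIMSEQ_subseq_LIMSEQ[OF b \<rho>] a have "norm1 k (G l) = 0"
      by (auto simp: o_def intro: LIMSEQ_unique)
    then have "norm1 m l = 0" using nz[of l] by (simp add: norm1_eq_0_iff)
    with l1 show False by simp
  qed
  then show ?thesis using that by blast
qed

text \<open>Counting lattice points: an $N$-grid on the source has $O(N^m)$ cells, each mapped into a
  cell of size less than $1/N$, too few to reach all $(N+1)^{m+1}$ points of the target grid.\<close>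

lemma lip_hom_misses_direction:
  assumes G: "lip_hom m C G" and nz: "\<And>x. \<forall>i\<le>Suc m. G x i = 0 \<Longrightarrow> \<forall>j\<le>m. x j = 0"
  obtains p where "\<And>i. 1 \<le> p i" "\<And>i. p i \<le> 2" "\<And>x. \<not> (\<forall>i\<le>Suc m. G x i = p i)"
proof -
  have "\<exists>p. (\<forall>i. 1 \<le> p i \<and> p i \<le> 2) \<and> (\<forall>x. \<not> (\<forall>i\<le>Suc m. G x i = p i))"
  proof (rule ccontr)
    assume "\<not> ?thesis"
    then have surj: "\<And>p. (\<forall>i. 1 \<le> p i \<and> p i \<le> 2) \<Longrightarrow> \<exists>x. \<forall>i\<le>Suc m. G x i = p i" by blast
    obtain c where c: "c > 0" "\<And>x. c * norm1 m x \<le> norm1 (Suc m) (G x)"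
      using lip_hom_lower_bound[OF G nz] by blast
    \<comment> \<open>\<open>R\<close> bounds the coordinates of preimages of targets in the cube
      with sides [1,2]. \<open>c0\<close> makes a source cell of side 1/(N * c0) have an image of
      size below 1/N. With A = N * c0 there are at most b * N cell indices per axis, and N = b ^
      (m+1) turns (b * N) ^ (m+1) into N ^ (m+2), less than the number of targets.\<close>
    obtain R :: nat where R: "real R > 2 * real (m+2) / c" using reals_Archimedean2 by blast
    obtain c0 :: nat where c0: "real c0 > \<bar>C\<bar> * real (m+1) + 1" using reals_Archimedean2 by blast
    have "\<bar>C\<bar> * real (m+1) \<ge> 0" by simp
    with c0 have "real c0 > 0" by linarith
    then have c0p: "c0 > 0" by simp
    define b where "b = 2 * (R * c0 + 1) + 1"
    define N where "N = b ^ (m+1)"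
    have Np: "N > 0" by (simp add: N_def b_def)
    define A where "A = N * c0"
    define T where "T = {..Suc m} \<rightarrow>\<^sub>E {..N}"
    \<comment> \<open>The \<open>min\<close> and the default 1 keep \<open>P q\<close> in the cube
      for every \<open>q\<close>, so a preimage can be chosen without first restricting
      \<open>q\<close> to \<open>T\<close>.\<close>
    define P where "P = (\<lambda>q i. if i \<le> Suc m then 1 + real (min (q i) N) / real N else 1)"
    have "\<exists>x. \<forall>i\<le>Suc m. G x i = P q i" for q
      using surj[of "P q"] Np by (auto simp: P_def)
    then obtain X where X: "\<And>q i. i \<le> Suc m \<Longrightarrow> G (X q) i = P q i" by metis
    have XR: "\<bar>X q j\<bar> \<le> real R" if "q \<in> T" "j \<le> m" for q j
    proof -
      have "norm1 (Suc m) (G (X q)) \<le> (\<Sum>i\<le>Suc m. 2)"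
        unfolding norm1_def
      proof (rule sum_mono)
        fix i assume i: "i \<in> {..Suc m}"
        have "real (min (q i) N) / real N \<le> 1" using Np by simp
        then show "\<bar>G (X q) i\<bar> \<le> 2" using i X[of i q] by (simp add: P_def)
      qed
      then have "c * norm1 m (X q) \<le> 2 * real (m+2)" using c(2)[of "X q"] by simp
      then have "norm1 m (X q) \<le> 2 * real (m+2) / c" using c(1) by (simp add: field_simps)
      then show ?thesis using R abs_le_norm1[OF that(2), of "X q"] by linarith
    qed
    \<comment> \<open>\<open>Z q\<close> is the index of the source cell containing the preimage of
      the target \<open>P q\<close>. Distinct targets need distinct cells.\<close>
    define Z where "Z = (\<lambda>q. \<lambda>j\<in>{..m}. \<lfloor>real A * X q j\<rfloor>)"
    have "inj_on Z T"
    proof (rule inj_onI)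
      fix q q' assume q: "q \<in> T" "q' \<in> T" and eq: "Z q = Z q'"
      have close: "real A * \<bar>X q j - X q' j\<bar> \<le> 1" if "j \<le> m" for j
      proof -
        have "\<lfloor>real A * X q j\<rfloor> = \<lfloor>real A * X q' j\<rfloor>"
          using fun_cong[OF eq, of j] that by (simp add: Z_def)
        then have "\<bar>real A * X q j - real A * X q' j\<bar> \<le> 1" by linarith
        then show ?thesis by (simp add: abs_mult right_diff_distrib[symmetric])
      qed
      have Ap: "real A > 0" using Np c0p by (simp add: A_def)
      have n1: "real A * norm1 m (\<lambda>j. X q j - X q' j) \<le> real (m+1)"
        unfolding norm1_def sum_distrib_left
        using sum_mono[of "{..m}" "\<lambda>j. real A * \<bar>X q j - X q' j\<bar>" "\<lambda>_. 1"] close by simp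
      show "q = q'"
      proof (rule PiE_ext[of _ "{..Suc m}" "\<lambda>_. {..N}"])
        fix i assume i: "i \<in> {..Suc m}"
        let ?n = "norm1 m (\<lambda>j. X q j - X q' j)"
        have "\<bar>P q i - P q' i\<bar> \<le> C * ?n"
          using lip_homD(1)[OF G, of "X q" i "X q'"] X i by simp
        also have "\<dots> \<le> \<bar>C\<bar> * ?n" by (simp add: mult_right_mono norm1_nonneg)
        finally have "real A * \<bar>P q i - P q' i\<bar> \<le> \<bar>C\<bar> * (real A * ?n)"
          using Ap by (simp add: mult.left_commute)
        also have "\<dots> \<le> \<bar>C\<bar> * real (m+1)" using n1 by (intro mult_left_mono) auto
        also have "\<dots> < real c0" using c0 by linarith
        finally have "real N * \<bar>P q i - P q' i\<bar> < 1" using c0p by (simp add: A_def mult.commute mult.assoc)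
        moreover have "real N * \<bar>P q i - P q' i\<bar> = \<bar>real (q i) - real (q' i)\<bar>"
        proof -
          have "q i \<le> N" "q' i \<le> N" using q i by (auto simp: T_def PiE_def Pi_def)
          then have "P q i - P q' i = (real (q i) - real (q' i)) / real N"
            using i by (simp add: P_def diff_divide_distrib)
          then show ?thesis using Np by (simp add: abs_divide)
        qed
        ultimately show "q i = q' i" by linarith
      qed (use q in \<open>auto simp: T_def\<close>)
    qed
    moreover have "Z ` T \<subseteq> {..m} \<rightarrow>\<^sub>E {-int (R * A) - 1..int (R * A) + 1}"
    proof
      fix z assume "z \<in> Z ` T"
      then obtain q where q: "q \<in> T" "z = Z q" by auto
      have "\<lfloor>real A * X q j\<rfloor> \<in> {-int (R * A) - 1..int (R * A) + 1}" if "j \<le> m" for j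
      proof -
        have "\<bar>real A * X q j\<bar> \<le> real A * real R"
          using XR[OF q(1) that] by (simp add: abs_mult mult_left_mono)
        then have "\<bar>real A * X q j\<bar> \<le> real_of_int (int (R * A))" by (simp add: mult.commute)
        then show ?thesis by (simp only: atLeastAtMost_iff) linarith
      qed
      then show "z \<in> {..m} \<rightarrow>\<^sub>E {-int (R * A) - 1..int (R * A) + 1}"
        by (auto simp: q(2) Z_def)
    qed
    ultimately have "card T \<le> card ({..m} \<rightarrow>\<^sub>E {-int (R * A) - 1..int (R * A) + 1})"
      by (metis (no_types, lifting) card_image card_mono finite_PiE finite_atLeastAtMost_int finite_atMost)
    moreover have "card {-int (R * A) - 1..int (R * A) + 1} = 2 * (R * A + 1) + 1"
      by (simp add: nat_eq_iff)
    ultimately have "(N+1) ^ (m+2) \<le> (2 * (R * A + 1) + 1) ^ (m+1)"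
      by (simp only: T_def card_PiE finite_atMost prod_constant card_atMost) simp
    also have "\<dots> \<le> (b * N) ^ (m+1)"
    proof (rule power_mono)
      have "1 \<le> N" using Np by simp
      then have "2 * (R * A + 1) + 1 \<le> 2 * (R * A + N) + N"
        by (intro add_le_mono mult_le_mono2 order_refl)
      also have "\<dots> = b * N" by (simp add: b_def A_def algebra_simps)
      finally show "2 * (R * A + 1) + 1 \<le> b * N" .
    qed simp
    also have "\<dots> = N ^ (m+2)" by (simp add: N_def power_mult_distrib power_add[symmetric] flip: power_mult) 
    also have "\<dots> < (N+1) ^ (m+2)" by (rule power_strict_mono) auto
    finally show False by simp
  qed
  then show ?thesis using that by blast
qed


section \<open>Normalized maps between spheres and their degree\<close>

abbreviation sphere_set :: "nat \<Rightarrow> (nat \<Rightarrow> real) set" where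
  "sphere_set m \<equiv> {x. (\<Sum>i\<le>m. x i ^ 2) = 1 \<and> (\<forall>i>m. x i = 0)}"

lemma nsphere_top_of_set: "nsphere m = top_of_set (sphere_set m)"
  by (simp add: nsphere euclidean_product_topology)

lemma topspace_nsphere: "topspace (nsphere m) = sphere_set m"
  by (simp add: nsphere)

lemma sum_squares_pos:
  fixes y :: "nat \<Rightarrow> real"
  assumes "\<not> (\<forall>i\<le>m. y i = 0)"
  shows "0 < (\<Sum>j\<le>m. (y j)\<^sup>2)"
proof -
  from assms obtain i where "i \<le> m" "y i \<noteq> 0" by blast
  then show ?thesis by (intro sum_pos2[of _ i]) auto
qed

lemma normalize_to_in_sphere:
  assumes "\<not> (\<forall>i\<le>m. y i = 0)"
  shows "normalize_to m y \<in> sphere_set m"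
proof -
  let ?s = "\<Sum>j\<le>m. (y j)\<^sup>2"
  have s: "?s > 0" using sum_squares_pos[OF assms] .
  have "(\<Sum>i\<le>m. (normalize_to m y i)\<^sup>2) = (\<Sum>i\<le>m. (y i)\<^sup>2 / ?s)"
    by (rule sum.cong) (use s in \<open>auto simp: normalize_to_def power_divide\<close>)
  also have "\<dots> = 1" using s by (simp flip: sum_divide_distrib)
  finally show ?thesis by (simp add: normalize_to_def)
qed

lemma continuous_on_normalize_to:
  assumes "\<And>i. i \<le> m \<Longrightarrow> continuous_on S (\<lambda>x. F x i)"
    and "\<And>x. x \<in> S \<Longrightarrow> \<not> (\<forall>i\<le>m. F x i = 0)"
  shows "continuous_on S (\<lambda>x. normalize_to m (F x))"
proof (rule continuous_on_coordinatewise_then_product)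
  fix i
  show "continuous_on S (\<lambda>x. normalize_to m (F x) i)"
  proof (cases "i \<le> m")
    case True
    have "continuous_on S (\<lambda>x. F x i / sqrt (\<Sum>j\<le>m. (F x j)\<^sup>2))"
    proof (intro continuous_intros assms True ballI)
      fix x assume "x \<in> S"
      from sum_squares_pos[OF assms(2)[OF this]]
      show "sqrt (\<Sum>j\<le>m. (F x j)\<^sup>2) \<noteq> 0" by simp
    qed auto
    then show ?thesis using True by (simp add: normalize_to_def)
  qed (simp add: normalize_to_def)
qed

lemma continuous_map_normalize_to:
  assumes "\<And>i. i \<le> m \<Longrightarrow> continuous_on (sphere_set n) (\<lambda>x. F x i)"
    and "\<And>x. x \<in> sphere_set n \<Longrightarrow> \<not> (\<forall>i\<le>m. F x i = 0)"
  shows "continuous_map (nsphere n) (nsphere m) (\<lambda>x. normalize_to m (F x))"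
  unfolding nsphere_top_of_set
  using continuous_on_normalize_to[OF assms] normalize_to_in_sphere[OF assms(2)] by force

text \<open>The segment from \<open>F x\<close> to \<open>H x\<close> misses the origin, so the
  straight-line homotopy can be normalized at every time.\<close>

lemma homotopic_normalize_to:
  assumes F: "\<And>i. i \<le> m \<Longrightarrow> continuous_on (sphere_set n) (\<lambda>x. F x i)"
    and H: "\<And>i. i \<le> m \<Longrightarrow> continuous_on (sphere_set n) (\<lambda>x. H x i)"
    and nz: "\<And>x t. x \<in> sphere_set n \<Longrightarrow> 0 \<le> t \<Longrightarrow> t \<le> 1 \<Longrightarrow> \<not> (\<forall>i\<le>m. (1 - t) * F x i + t * H x i = 0)"
  shows "homotopic_with (\<lambda>x. True) (nsphere n) (nsphere m)
    (\<lambda>x. normalize_to m (F x)) (\<lambda>x. normalize_to m (H x))"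
proof -
  let ?K = "\<lambda>z i. (1 - fst z) * F (snd z) i + fst z * H (snd z) i"
  let ?S = "{0..1::real} \<times> sphere_set n"
  have c: "continuous_on ?S (\<lambda>z. F (snd z) i)" "continuous_on ?S (\<lambda>z. H (snd z) i)" if "i \<le> m" for i
    by (auto intro!: continuous_on_compose2[OF F[OF that]] continuous_on_compose2[OF H[OF that]]
        continuous_on_snd continuous_on_id)
  have cont: "continuous_on ?S (\<lambda>z. normalize_to m (?K z))"
  proof (rule continuous_on_normalize_to)
    show "continuous_on ?S (\<lambda>z. ?K z i)" if "i \<le> m" for i
      by (intro continuous_intros c that)
    show "\<not> (\<forall>i\<le>m. ?K z i = 0)" if "z \<in> ?S" for z
      using that by (intro nz) auto
  qed
  have im: "(\<lambda>z. normalize_to m (?K z)) ` ?S \<subseteq> sphere_set m"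
  proof (rule image_subsetI)
    fix z assume "z \<in> ?S"
    then have "\<not> (\<forall>i\<le>m. ?K z i = 0)" by (intro nz) auto
    then show "normalize_to m (?K z) \<in> sphere_set m" by (rule normalize_to_in_sphere)
  qed
  show ?thesis
    unfolding homotopic_with_def nsphere_top_of_set
    using cont im by (intro exI[of _ "\<lambda>z. normalize_to m (?K z)"]) (auto simp: prod_topology_subtopology_eu)
qed

lemma continuous_on_coordinate: "continuous_on S (\<lambda>x::nat\<Rightarrow>real. x i)"
  by (rule continuous_on_subset[OF continuous_on_product_coordinates subset_UNIV])

text \<open>The antipodal map is its own inverse, hence a homeomorphism of degree 1 or -1.\<close>

lemma Brouwer_degree2_uminus_odd: "odd (Brouwer_degree2 p (\<lambda>x i. - x i))"
proof -
  let ?n = "\<lambda>(x::nat\<Rightarrow>real) i. - x i"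
  have c: "continuous_map (nsphere p) (nsphere p) ?n"
    unfolding nsphere_top_of_set
    by (auto intro!: continuous_on_coordinatewise_then_product continuous_intros continuous_on_coordinate)
  have "homeomorphic_maps (nsphere p) (nsphere p) ?n ?n"
    using c by (simp add: homeomorphic_maps_def)
  then have "\<bar>Brouwer_degree2 p ?n\<bar> = 1"
    using Brouwer_degree2_homeomorphic_maps by blast
  then have "Brouwer_degree2 p ?n = 1 \<or> Brouwer_degree2 p ?n = -1" by linarith
  then show ?thesis by (elim disjE) simp_all
qed

text \<open>Induction on the dimension. The map is deformed into an odd map that preserves the
  equator and restricts there to a normalized map of the same kind; the two degrees then have the
  same parity.\<close>

theorem odd_degree_lip_hom:
  assumes G: "lip_hom m C G" and nz: "\<And>x. \<forall>i\<le>m. G x i = 0 \<Longrightarrow> \<forall>j\<le>m. x j = 0"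
  shows "odd (Brouwer_degree2 m (\<lambda>x. normalize_to m (G x)))"
  using assms
proof (induction m arbitrary: C G)
  case 0
  define e :: "nat \<Rightarrow> real" where "e = (\<lambda>i. if i = 0 then 1 else 0)"
  define g where "g = G e 0"
  \<comment> \<open>\<open>norm1 0\<close> sees only coordinate 0, so \<open>x\<close> may be
    replaced by \<open>x 0 * e\<close>, and homogeneity makes \<open>G\<close> linear.\<close>
  have eq: "G x 0 = x 0 * g" for x
  proof -
    have "G (\<lambda>j. x 0 * e j) 0 = x 0 * G e 0" by (rule lip_homD(2)[OF 0(1)])
    moreover have "G x 0 = G (\<lambda>j. x 0 * e j) 0"
      using lip_homD(1)[OF 0(1), of x 0 "\<lambda>j. x 0 * e j"] by (simp add: norm1_def e_def)
    ultimately show ?thesis by (simp add: g_def)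
  qed
  have "g \<noteq> 0" using 0(2)[of e] by (auto simp: e_def g_def)
  then consider "g > 0" | "g < 0" by linarith
  then show ?case
  proof cases
    case 1
    have "Brouwer_degree2 0 (\<lambda>x. normalize_to 0 (G x)) = Brouwer_degree2 0 id"
    proof (rule Brouwer_degree2_eq, rule ext)
      fix x i assume "x \<in> topspace (nsphere 0)"
      then have "\<bar>x 0\<bar> = 1" "\<forall>i>0. x i = 0"
        by (simp_all add: topspace_nsphere abs_square_eq_1)
      then show "normalize_to 0 (G x) i = id x i"
        using 1 by (auto simp: normalize_to_def eq abs_mult)
    qed
    then show ?thesis by simp
  next
    case 2
    have "Brouwer_degree2 0 (\<lambda>x. normalize_to 0 (G x)) = Brouwer_degree2 0 (\<lambda>x i. - x i)"
    proof (rule Brouwer_degree2_eq, rule ext)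
      fix x i assume "x \<in> topspace (nsphere 0)"
      then have "\<bar>x 0\<bar> = 1" "\<forall>i>0. x i = 0"
        by (simp_all add: topspace_nsphere abs_square_eq_1)
      then show "normalize_to 0 (G x) i = - x i"
        using 2 by (auto simp: normalize_to_def eq abs_mult)
    qed
    then show ?thesis using Brouwer_degree2_uminus_odd by simp
  qed
next
  case (Suc m)
  \<comment> \<open>Truncation restricts \<open>G\<close> to the hyperplane of the equator: m+1
    variables against m+2 values, so a direction \<open>p\<close> is missed. As all
    \<open>p i\<close> lie in [1,2], one may divide by \<open>p (Suc m)\<close>, and the ratios are
    at most 2.\<close>
  define trunc :: "(nat \<Rightarrow> real) \<Rightarrow> nat \<Rightarrow> real" where "trunc = (\<lambda>x j. if j \<le> m then x j else 0)"
  have norm1_trunc: "norm1 (Suc m) (\<lambda>j. trunc x j - trunc y j) = norm1 m (\<lambda>j. x j - y j)" for x y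
    by (auto simp: norm1_def trunc_def intro!: sum.cong)
  have Gt: "lip_hom m C (\<lambda>x. G (trunc x))"
    unfolding lip_hom_def
  proof (intro conjI allI)
    show "\<bar>G (trunc x) i - G (trunc y) i\<bar> \<le> C * norm1 m (\<lambda>j. x j - y j)" for x y i
      using lip_homD(1)[OF Suc.prems(1), of "trunc x" i "trunc y"] by (simp add: norm1_trunc)
    have "trunc (\<lambda>j. t * x j) = (\<lambda>j. t * trunc x j)" for t x by (auto simp: trunc_def)
    then show "G (trunc (\<lambda>j. t * x j)) i = t * G (trunc x) i" for t x i
      by (simp add: lip_homD(2)[OF Suc.prems(1)])
  qed
  have Gtnz: "\<forall>j\<le>m. x j = 0" if "\<forall>i\<le>Suc m. G (trunc x) i = 0" for x
    using Suc.prems(2)[OF that] by (metis le_SucI trunc_def)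
  obtain p where p: "\<And>i. 1 \<le> p i" "\<And>i. p i \<le> 2" "\<And>x. \<not> (\<forall>i\<le>Suc m. G (trunc x) i = p i)"
    using lip_hom_misses_direction[OF Gt Gtnz] by blast
  have p0: "p i > 0" for i using p(1)[of i] by linarith
  \<comment> \<open>\<open>Q\<close> is \<open>G\<close> followed by the projection along
    \<open>p\<close> onto the hyperplane where coordinate \<open>Suc m\<close> is 0.\<close>
  define Q where "Q = (\<lambda>x i. G x i - G x (Suc m) / p (Suc m) * p i)"
  define G' where "G' = (\<lambda>x. Q (trunc x))"
  have notmult: "\<forall>j\<le>m. x j = 0" if "\<forall>i\<le>Suc m. G (trunc x) i = s * p i" for x s
  proof (cases "s = 0")
    case True
    then show ?thesis using Gtnz[of x] that by simp
  next
    case False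
    have "\<forall>i\<le>Suc m. G (trunc (\<lambda>j. inverse s * x j)) i = p i"
      unfolding lip_homD(2)[OF Gt] using that False by simp
    then show ?thesis using p(3) by blast
  qed
  have QSuc: "Q x (Suc m) = 0" for x using p0[of "Suc m"] by (simp add: Q_def)
  have G'nz: "\<forall>j\<le>m. x j = 0" if "\<forall>i\<le>m. G' x i = 0" for x
  proof (rule notmult)
    show "\<forall>i\<le>Suc m. G (trunc x) i = G (trunc x) (Suc m) / p (Suc m) * p i"
      using that QSuc[of "trunc x"] by (auto simp: G'_def Q_def le_Suc_eq)
  qed
  \<comment> \<open>One \<open>C\<close> comes from \<open>G\<close> and two from the projected
    part, whose coefficient p i / p (Suc m) is at most 2.\<close>
  have G'l: "lip_hom m (3 * C) G'"
    unfolding lip_hom_def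
  proof (intro conjI allI)
    fix x y i
    define D where "D = C * norm1 m (\<lambda>j. x j - y j)"
    have d: "\<bar>G (trunc x) k - G (trunc y) k\<bar> \<le> D" for k
      using lip_homD(1)[OF Gt] by (simp add: D_def)
    then have D0: "D \<ge> 0" by (meson abs_ge_zero order_trans)
    define q where "q = p i / p (Suc m)"
    have "q \<le> 2" unfolding q_def
      using p(1)[of "Suc m"] p(2)[of i] p0[of "Suc m"] by (simp add: pos_divide_le_eq)
    moreover have "q \<ge> 0" using p0[of i] p0[of "Suc m"] by (simp add: q_def)
    ultimately have "q * \<bar>G (trunc x) (Suc m) - G (trunc y) (Suc m)\<bar> \<le> 2 * D"
      using d[of "Suc m"] D0 by (intro mult_mono) auto
    moreover have "\<bar>q * (G (trunc x) (Suc m) - G (trunc y) (Suc m))\<bar>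
        = q * \<bar>G (trunc x) (Suc m) - G (trunc y) (Suc m)\<bar>"
      using \<open>q \<ge> 0\<close> by (simp add: abs_mult)
    moreover have "G' x i - G' y i = (G (trunc x) i - G (trunc y) i)
        - q * (G (trunc x) (Suc m) - G (trunc y) (Suc m))"
      by (simp add: G'_def Q_def q_def algebra_simps diff_divide_distrib)
    ultimately have "\<bar>G' x i - G' y i\<bar> \<le> D + 2 * D"
      using d[of i] by linarith
    then show "\<bar>G' x i - G' y i\<bar> \<le> 3 * C * norm1 m (\<lambda>j. x j - y j)" by (simp add: D_def)
  next
    show "G' (\<lambda>j. t * x j) i = t * G' x i" for t x i
      using lip_homD(2)[OF Gt] by (simp add: G'_def Q_def algebra_simps)
  qed
  have IH: "odd (Brouwer_degree2 m (\<lambda>x. normalize_to m (G' x)))"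
    by (rule Suc.IH[OF G'l G'nz])
  \<comment> \<open>\<open>H\<close> projects along \<open>p\<close> on the equator, which it therefore preserves; the straight line from
    \<open>G\<close> to \<open>H\<close> avoids \<open>0\<close> because \<open>G\<close> maps no point of the equator to a multiple of \<open>p\<close>.\<close>
  define H where "H = (\<lambda>x i. G x i - (1 - \<bar>x (Suc m)\<bar>) * (G x (Suc m) / p (Suc m) * p i))"
  define f where "f = (\<lambda>x. normalize_to (Suc m) (H x))"
  have sphere_ne: "\<not> (\<forall>j\<le>Suc m. x j = 0)" if "x \<in> sphere_set (Suc m)" for x
  proof
    assume "\<forall>j\<le>Suc m. x j = 0"
    then have "(\<Sum>i\<le>Suc m. (x i)\<^sup>2) = 0" by simp
    with that show False by simp
  qed
  have nzt: "\<not> (\<forall>i\<le>Suc m. (1 - t) * G x i + t * H x i = 0)"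
    if x: "x \<in> sphere_set (Suc m)" and t: "0 \<le> t" "t \<le> 1" for x t
  proof
    assume *: "\<forall>i\<le>Suc m. (1 - t) * G x i + t * H x i = 0"
    \<comment> \<open>If the combination vanishes, \<open>G x\<close> is a multiple of
      \<open>p\<close> with coefficient s * G x (Suc m) / p (Suc m). Coordinate \<open>Suc m\<close>
      then forces s = 1 or G x (Suc m) = 0. Since t \<le> 1, the case s = 1 occurs only on the
      equator, where \<open>notmult\<close> applies; in the other case all of \<open>G x\<close> is
      0.\<close>
    define s where "s = t * (1 - \<bar>x (Suc m)\<bar>)"
    have eq: "G x i = s * (G x (Suc m) / p (Suc m)) * p i" if "i \<le> Suc m" for i
    proof -
      have "(1 - t) * G x i + t * H x i = G x i - s * (G x (Suc m) / p (Suc m)) * p i"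
        by (simp add: H_def s_def algebra_simps)
      moreover have "(1 - t) * G x i + t * H x i = 0" using * that by blast
      ultimately show ?thesis by linarith
    qed
    have "G x (Suc m) = s * G x (Suc m)"
      using eq[of "Suc m"] p0[of "Suc m"] by simp
    then consider "G x (Suc m) = 0" | "s = 1" by auto
    then show False
    proof cases
      case 1
      have "G x i = 0" if "i \<le> Suc m" for i
        using eq[OF that] 1 by simp
      then show False using Suc.prems(2)[of x] sphere_ne[OF x] by blast
    next
      case 2
      have "s \<le> 1 - \<bar>x (Suc m)\<bar>" if "\<bar>x (Suc m)\<bar> \<le> 1"
        unfolding s_def using mult_right_mono[of t 1 "1 - \<bar>x (Suc m)\<bar>"] t that by simp
      moreover have "s \<le> 0" if "\<bar>x (Suc m)\<bar> > 1"
        unfolding s_def using t that by (simp add: mult_nonneg_nonpos)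
      ultimately have x0: "x (Suc m) = 0" using 2 by linarith
      then have t: "trunc x = x" using x by (auto simp: trunc_def fun_eq_iff not_le) (metis Suc_lessI)
      have "\<forall>j\<le>m. x j = 0"
      proof (rule notmult, intro allI impI)
        fix i assume "i \<le> Suc m"
        from eq[OF this] show "G (trunc x) i = s * (G x (Suc m) / p (Suc m)) * p i"
          unfolding t .
      qed
      then show False using sphere_ne[OF x] x0 by (auto simp: le_Suc_eq)
    qed
  qed
  have Gc: "continuous_on S (\<lambda>x. G x i)" for S i by (rule lip_hom_continuous_on[OF Suc.prems(1)])
  have Hc: "continuous_on S (\<lambda>x. H x i)" for S i
    unfolding H_def using p0[of "Suc m"]
    by (intro continuous_intros Gc continuous_on_coordinate) auto
  have "homotopic_with (\<lambda>x. True) (nsphere (Suc m)) (nsphere (Suc m))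
      (\<lambda>x. normalize_to (Suc m) (G x)) f"
    unfolding f_def by (rule homotopic_normalize_to[OF Gc Hc nzt])
  then have deg1: "Brouwer_degree2 (Suc m) (\<lambda>x. normalize_to (Suc m) (G x)) = Brouwer_degree2 (Suc m) f"
    by (rule Brouwer_degree2_homotopic)
  have fc: "continuous_map (nsphere (Suc m)) (nsphere (Suc m)) f"
    unfolding f_def
    by (rule continuous_map_normalize_to[OF Hc]) (use nzt[of _ 1] in simp)
  have fodd: "(f \<circ> (\<lambda>x i. - x i)) u = ((\<lambda>x i. - x i) \<circ> f) u" for u
  proof -
    have "H (\<lambda>i. - u i) = (\<lambda>i. - H u i)"
      by (intro ext) (simp add: H_def lip_hom_uminus[OF Suc.prems(1)])
    then show ?thesis by (auto simp: f_def normalize_to_def)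
  qed
  \<comment> \<open>On the equator the factor 1 - \<bar>x (Suc m)\<bar> is 1, so \<open>H\<close> is
    the full projection. Its coordinate \<open>Suc m\<close> is 0, so normalizing in either
    dimension gives the same result.\<close>
  have feq: "f x = normalize_to m (G' x)" if "x \<in> topspace (nsphere m)" for x
  proof -
    from that have x: "\<forall>i>m. x i = 0" by (simp add: topspace_nsphere)
    then have t: "trunc x = x" by (auto simp: trunc_def fun_eq_iff not_le)
    have "H x = G' x" using x by (auto simp: H_def G'_def Q_def t)
    then show ?thesis using QSuc[of x]
      by (auto simp: f_def normalize_to_def G'_def t fun_eq_iff le_Suc_eq)
  qed
  have fim: "f \<in> topspace (nsphere (Suc m - Suc 0)) \<rightarrow> topspace (nsphere (Suc m - Suc 0))"
  proof
    fix x assume x: "x \<in> topspace (nsphere (Suc m - Suc 0))"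
    then have "x \<in> sphere_set m" by (simp add: topspace_nsphere)
    then have "\<not> (\<forall>i\<le>m. x i = 0)" by (intro notI) simp
    then have "\<not> (\<forall>i\<le>m. G' x i = 0)" using G'nz by blast
    from normalize_to_in_sphere[OF this] show "f x \<in> topspace (nsphere (Suc m - Suc 0))"
      using feq x by (simp add: topspace_nsphere)
  qed
  have "even (Brouwer_degree2 (Suc m) f - Brouwer_degree2 (Suc m - Suc 0) f)"
    by (rule Borsuk_odd_mapping_degree_step[OF fc fodd fim])
  moreover have "Brouwer_degree2 m f = Brouwer_degree2 m (\<lambda>x. normalize_to m (G' x))"
    by (rule Brouwer_degree2_eq[OF feq])
  ultimately show ?case using IH deg1 by simp
qed

text \<open>Without a common zero, padding the m functions with a zero coordinate gives a
  nonvanishing map whose normalization misses a pole. Its degree would be 0, yet it is odd.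
  Homogeneity rescales the zero to norm 1.\<close>

theorem Borsuk_Ulam_lip_hom:
  assumes G: "lip_hom m C G"
  obtains x where "\<forall>i<m. G x i = 0" "norm1 m x = 1"
proof -
  have "\<exists>x. (\<forall>i<m. G x i = 0) \<and> norm1 m x \<noteq> 0"
  proof (rule ccontr)
    assume *: "\<not> ?thesis"
    define G' where "G' = (\<lambda>x i. if i < m then G x i else 0)"
    have nz: "\<forall>j\<le>m. x j = 0" if "\<forall>i\<le>m. G' x i = 0" for x
    proof -
      have "\<forall>i<m. G x i = 0"
      proof (intro allI impI)
        fix i assume "i < m"
        then show "G x i = 0" using that[rule_format, of i] by (simp add: G'_def)
      qed
      with * have "norm1 m x = 0" by blast
      then show ?thesis by (simp add: norm1_eq_0_iff)
    qed
    have l: "lip_hom m C G'"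
      using G unfolding lip_hom_def G'_def
      by (auto intro: order_trans[OF abs_ge_zero])
    let ?f = "\<lambda>x. normalize_to m (G' x)"
    have c: "continuous_map (nsphere m) (nsphere m) ?f"
      by (rule continuous_map_normalize_to[OF lip_hom_continuous_on[OF l]]) (use nz in force)
    let ?e = "\<lambda>i. if i = m then 1 else 0 :: real"
    have "?e \<in> topspace (nsphere m)"
      by (auto simp: topspace_nsphere if_distrib[where f="\<lambda>x. x ^ 2"] cong: if_cong)
    moreover have "?e \<notin> ?f ` topspace (nsphere m)"
    proof
      assume "?e \<in> ?f ` topspace (nsphere m)"
      then obtain x where "?e = ?f x" by auto
      from fun_cong[OF this, of m] show False by (simp add: normalize_to_def G'_def)
    qed
    ultimately have "Brouwer_degree2 m ?f = 0"
      by (intro Brouwer_degree2_nonsurjective c) blast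
    with odd_degree_lip_hom[OF l nz] show False by simp
  qed
  then obtain x where x: "\<forall>i<m. G x i = 0" "norm1 m x \<noteq> 0" by blast
  show ?thesis
  proof (rule that)
    show "\<forall>i<m. G (\<lambda>j. inverse (norm1 m x) * x j) i = 0"
      using x(1) by (simp add: lip_homD(2)[OF G])
    show "norm1 m (\<lambda>j. inverse (norm1 m x) * x j) = 1"
      using x(2) norm1_nonneg[of m x] by (simp add: norm1_scale)
  qed
qed

section \<open>Bisecting finite sets\<close>

definition clamp_to :: "real \<Rightarrow> real \<Rightarrow> real" where
  "clamp_to a t = max (- a) (min a t)"

lemma clamp_to_minus: "a \<ge> 0 \<Longrightarrow> clamp_to a (- t) = - clamp_to a t"
  by (auto simp: clamp_to_def max_def min_def)

lemma clamp_to_scale: "a \<ge> 0 \<Longrightarrow> clamp_to (\<bar>s\<bar> * a) (s * t) = s * clamp_to a t"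
proof (cases "s \<ge> 0")
  case True
  then show ?thesis by (simp add: clamp_to_def max_mult_distrib_left min_mult_distrib_left)
next
  case False
  assume a: "a \<ge> 0"
  have "clamp_to (- s * a) (- s * t) = - s * clamp_to a t"
    using False unfolding clamp_to_def by (subst max_mult_distrib_left, subst min_mult_distrib_left) simp
  moreover have "clamp_to (- s * a) (- (s * t)) = - clamp_to (- s * a) (s * t)"
    using False a by (intro clamp_to_minus) (simp add: mult_nonpos_nonneg)
  ultimately show ?thesis using False by simp
qed

lemma clamp_to_lipschitz: "\<bar>clamp_to a t - clamp_to b s\<bar> \<le> \<bar>a - b\<bar> + \<bar>t - s\<bar>"
  by (auto simp: clamp_to_def max_def min_def abs_if)

text \<open>Points with g p \<ge> \<epsilon> contribute exactly \<epsilon> and all others at least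
  -\<epsilon>, so in a zero sum the former cannot outnumber the latter.\<close>

lemma sum_clamp_to_eq_0:
  assumes "finite A" "\<epsilon> > 0" "(\<Sum>p\<in>A. clamp_to \<epsilon> (g p)) = 0"
  shows "2 * card {p \<in> A. g p \<ge> \<epsilon>} \<le> card A"
proof -
  let ?U = "{p \<in> A. g p \<ge> \<epsilon>}"
  have "0 = (\<Sum>p\<in>?U. clamp_to \<epsilon> (g p)) + (\<Sum>p\<in>A - ?U. clamp_to \<epsilon> (g p))"
    using sum.subset_diff[of ?U A "\<lambda>p. clamp_to \<epsilon> (g p)"] assms(1,3) by (simp add: add.commute)
  also have "\<dots> \<ge> (\<Sum>p\<in>?U. \<epsilon>) + (\<Sum>p\<in>A - ?U. - \<epsilon>)"
    using assms(2) by (intro add_mono sum_mono) (auto simp: clamp_to_def)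
  finally have "\<epsilon> * (real (card ?U) - real (card (A - ?U))) \<le> 0"
    by (simp add: algebra_simps)
  then have "card ?U \<le> card (A - ?U)" using assms(2) by (simp add: mult_le_0_iff)
  moreover have "card (A - ?U) = card A - card ?U" "card ?U \<le> card A"
    using assms(1) by (auto intro!: card_Diff_subset card_mono)
  ultimately show ?thesis by linarith
qed

text \<open>The map sends coefficients \<open>c\<close> to the sums over \<open>A j\<close> of the value at \<open>p\<close>, clamped at height
  \<open>\<epsilon> * norm1 c\<close>; the clamping height makes it homogeneous.  Letting \<open>\<epsilon>\<close> tend to \<open>0\<close> along a
  convergent subsequence of its zeros gives the bisection.\<close>

lemma ham_sandwich_finite:
  fixes A :: "nat \<Rightarrow> 'a set" and b :: "nat \<Rightarrow> 'a \<Rightarrow> real"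
  assumes fin: "\<And>j. j < M \<Longrightarrow> finite (A j)"
  obtains c where "\<exists>i\<le>M. c i \<noteq> 0"
    and "\<And>j. j < M \<Longrightarrow> 2 * card {p \<in> A j. (\<Sum>i\<le>M. c i * b i p) > 0} \<le> card (A j)"
    and "\<And>j. j < M \<Longrightarrow> 2 * card {p \<in> A j. (\<Sum>i\<le>M. c i * b i p) < 0} \<le> card (A j)"
proof -
  define f where "f = (\<lambda>c p. \<Sum>i\<le>M. c i * b i p)"
  define S where "S = (\<lambda>p. \<Sum>i\<le>M. \<bar>b i p\<bar>)"
  have S0: "S p \<ge> 0" for p by (simp add: S_def sum_nonneg)
  have f_lip: "\<bar>f c p - f c' p\<bar> \<le> S p * norm1 M (\<lambda>i. c i - c' i)" for c c' p
  proof -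
    have "f c p - f c' p = (\<Sum>i\<le>M. (c i - c' i) * b i p)"
      by (simp add: f_def sum_subtractf[symmetric] left_diff_distrib)
    also have "\<bar>\<dots>\<bar> \<le> (\<Sum>i\<le>M. norm1 M (\<lambda>i. c i - c' i) * \<bar>b i p\<bar>)"
      by (intro order_trans[OF sum_abs] sum_mono) (auto simp: abs_mult intro!: mult_right_mono abs_le_norm1)
    finally show ?thesis by (simp add: S_def sum_distrib_right mult.commute)
  qed
  have "\<exists>c. norm1 M c = 1 \<and> (\<forall>j<M. (\<Sum>p\<in>A j. clamp_to (inverse (real (Suc n))) (f c p)) = 0)" for n
  proof -
    define \<epsilon> where "\<epsilon> = inverse (real (Suc n))"
    have \<epsilon>: "\<epsilon> > 0" by (simp add: \<epsilon>_def)
    \<comment> \<open>The default 0 beyond \<open>M\<close> and the constant \<open>C\<close>,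
      summed over all the sets, give one Lipschitz bound for every index.\<close>
    define G where "G = (\<lambda>c j. if j < M then \<Sum>p\<in>A j. clamp_to (\<epsilon> * norm1 M c) (f c p) else 0)"
    define C where "C = (\<Sum>j<M. \<Sum>p\<in>A j. \<epsilon> + S p)"
    have C0: "C \<ge> 0" unfolding C_def using \<epsilon> S0 by (intro sum_nonneg) (auto intro!: add_nonneg_nonneg)
    have "lip_hom M C G"
      unfolding lip_hom_def
    proof (intro conjI allI)
      fix c c' j
      let ?n = "norm1 M (\<lambda>i. c i - c' i)"
      show "\<bar>G c j - G c' j\<bar> \<le> C * ?n"
      proof (cases "j < M")
        case True
        have nd: "\<bar>norm1 M c - norm1 M c'\<bar> \<le> ?n"
          unfolding norm1_def sum_subtractf[symmetric]
          by (intro order_trans[OF sum_abs] sum_mono) simp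
        have "G c j - G c' j
            = (\<Sum>p\<in>A j. clamp_to (\<epsilon> * norm1 M c) (f c p) - clamp_to (\<epsilon> * norm1 M c') (f c' p))"
          using True by (simp add: G_def sum_subtractf)
        also have "\<bar>\<dots>\<bar> \<le> (\<Sum>p\<in>A j. (\<epsilon> + S p) * ?n)"
        proof (intro order_trans[OF sum_abs] sum_mono)
          fix p
          have "\<bar>clamp_to (\<epsilon> * norm1 M c) (f c p) - clamp_to (\<epsilon> * norm1 M c') (f c' p)\<bar>
             \<le> \<bar>\<epsilon> * norm1 M c - \<epsilon> * norm1 M c'\<bar> + \<bar>f c p - f c' p\<bar>"
            by (rule clamp_to_lipschitz)
          also have "\<bar>\<epsilon> * norm1 M c - \<epsilon> * norm1 M c'\<bar> = \<epsilon> * \<bar>norm1 M c - norm1 M c'\<bar>"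
            using \<epsilon> by (simp add: right_diff_distrib[symmetric] abs_mult)
          also have "\<dots> + \<bar>f c p - f c' p\<bar> \<le> \<epsilon> * ?n + S p * ?n"
            using \<epsilon> nd f_lip by (intro add_mono mult_left_mono) auto
          finally show "\<bar>clamp_to (\<epsilon> * norm1 M c) (f c p) - clamp_to (\<epsilon> * norm1 M c') (f c' p)\<bar>
              \<le> (\<epsilon> + S p) * ?n" by (simp add: distrib_right)
        qed
        also have "\<dots> = (\<Sum>p\<in>A j. \<epsilon> + S p) * ?n" by (simp add: sum_distrib_right)
        also have "\<dots> \<le> C * ?n"
          unfolding C_def using \<epsilon> S0 True
          by (intro mult_right_mono norm1_nonneg member_le_sum)
             (auto intro!: sum_nonneg add_nonneg_nonneg)
        finally show ?thesis .
      qed (use C0 in \<open>simp add: G_def norm1_nonneg\<close>)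
    next
      fix t c j
      have "f (\<lambda>i. t * c i) p = t * f c p" for p by (simp add: f_def sum_distrib_left mult.assoc)
      moreover have "clamp_to (\<epsilon> * (\<bar>t\<bar> * norm1 M c)) (t * s) = t * clamp_to (\<epsilon> * norm1 M c) s" for s
        using clamp_to_scale[of "\<epsilon> * norm1 M c" t s] \<epsilon> norm1_nonneg[of M c] by (simp add: mult.left_commute)
      ultimately show "G (\<lambda>i. t * c i) j = t * G c j"
        by (simp add: G_def norm1_scale sum_distrib_left)
    qed
    then obtain c where "\<forall>i<M. G c i = 0" "norm1 M c = 1" by (rule Borsuk_Ulam_lip_hom)
    then show ?thesis by (auto simp: G_def \<epsilon>_def)
  qed
  then obtain X where X: "\<And>n. norm1 M (X n) = 1"
    "\<And>n j. j < M \<Longrightarrow> (\<Sum>p\<in>A j. clamp_to (inverse (real (Suc n))) (f (X n) p)) = 0" by metis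
  obtain l \<rho> where \<rho>: "strict_mono \<rho>" and l: "\<And>i. i \<le> M \<Longrightarrow> (\<lambda>n. X (\<rho> n) i) \<longlonglongrightarrow> l i"
    using bounded_coordinates_convergent_subseq[of M X 1] X(1) abs_le_norm1 by metis
  have "(\<lambda>n. norm1 M (X (\<rho> n))) \<longlonglongrightarrow> norm1 M l"
    unfolding norm1_def by (intro tendsto_intros l) auto
  then have l1: "norm1 M l = 1" using X(1) by (simp add: LIMSEQ_const_iff)
  have \<epsilon>lim: "(\<lambda>n. inverse (real (Suc (\<rho> n)))) \<longlonglongrightarrow> 0"
    using LIMSEQ_subseq_LIMSEQ[OF LIMSEQ_inverse_real_of_nat \<rho>] by (simp add: o_def)
  have flim: "(\<lambda>n. f (X (\<rho> n)) p) \<longlonglongrightarrow> f l p" for p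
    unfolding f_def by (intro tendsto_intros l) auto
  \<comment> \<open>The sign \<open>s\<close> treats both sides at once. The finitely many points
    strictly on one side of the limit eventually all have values above the clamping height, so the
    bound for clamped sums passes to the limit.\<close>
  have bal: "2 * card {p \<in> A j. s * f l p > 0} \<le> card (A j)" if j: "j < M" and s: "s = 1 \<or> s = -1" for j s
  proof -
    have "\<forall>\<^sub>F n in sequentially. \<forall>p\<in>{p \<in> A j. s * f l p > 0}. s * f (X (\<rho> n)) p - inverse (real (Suc (\<rho> n))) > 0"
    proof (rule eventually_ball_finite)
      show "\<forall>p\<in>{p \<in> A j. s * f l p > 0}. \<forall>\<^sub>F n in sequentially. s * f (X (\<rho> n)) p - inverse (real (Suc (\<rho> n))) > 0"
      proof
        fix p assume p: "p \<in> {p \<in> A j. s * f l p > 0}"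
        have "(\<lambda>n. s * f (X (\<rho> n)) p - inverse (real (Suc (\<rho> n)))) \<longlonglongrightarrow> s * f l p - 0"
          by (intro tendsto_intros flim \<epsilon>lim)
        then show "\<forall>\<^sub>F n in sequentially. s * f (X (\<rho> n)) p - inverse (real (Suc (\<rho> n))) > 0"
          by (rule order_tendstoD) (use p in simp)
      qed
    qed (use fin j in auto)
    then obtain n where n: "\<forall>p\<in>{p \<in> A j. s * f l p > 0}. s * f (X (\<rho> n)) p - inverse (real (Suc (\<rho> n))) > 0"
      by (auto dest: eventually_happens)
    let ?e = "inverse (real (Suc (\<rho> n)))"
    have "card {p \<in> A j. s * f l p > 0} \<le> card {p \<in> A j. s * f (X (\<rho> n)) p \<ge> ?e}"
      using n fin[OF j] by (intro card_mono) force+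
    moreover have "2 * card {p \<in> A j. s * f (X (\<rho> n)) p \<ge> ?e} \<le> card (A j)"
    proof (rule sum_clamp_to_eq_0[OF fin[OF j]])
      have "clamp_to ?e (s * f (X (\<rho> n)) p) = s * clamp_to ?e (f (X (\<rho> n)) p)" for p
        using s clamp_to_minus[of ?e] by auto
      then show "(\<Sum>p\<in>A j. clamp_to ?e (s * f (X (\<rho> n)) p)) = 0"
        using X(2)[OF j, of "\<rho> n"] by (simp add: sum_distrib_left[symmetric] del: of_nat_Suc)
    qed simp
    ultimately show ?thesis by linarith
  qed
  show ?thesis
  proof (rule that[of l])
    show "\<exists>i\<le>M. l i \<noteq> 0" using l1 norm1_eq_0_iff[of M l] by auto
    show "2 * card {p \<in> A j. (\<Sum>i\<le>M. l i * b i p) > 0} \<le> card (A j)" if "j < M" for j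
      using bal[OF that, of 1] by (simp add: f_def)
    show "2 * card {p \<in> A j. (\<Sum>i\<le>M. l i * b i p) < 0} \<le> card (A j)" if "j < M" for j
      using bal[OF that, of "-1"] by (simp add: f_def)
  qed
qed

section \<open>Polynomial functions on Euclidean space\<close>

text \<open>Polynomials appear as functions, with \<open>D\<close> only an upper bound for the
  degree; being nonzero is expressed by a point with nonzero value.\<close>

inductive poly_fun :: "nat \<Rightarrow> (real ^ 'n \<Rightarrow> real) \<Rightarrow> bool" where
  const: "poly_fun D (\<lambda>_. c)"
| add: "poly_fun D f \<Longrightarrow> poly_fun D g \<Longrightarrow> poly_fun D (\<lambda>x. f x + g x)"
| coord: "poly_fun D f \<Longrightarrow> poly_fun (Suc D) (\<lambda>x. x $ i * f x)"

lemma poly_fun_mono: "poly_fun D f \<Longrightarrow> D \<le> E \<Longrightarrow> poly_fun E f"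
proof (induction arbitrary: E rule: poly_fun.induct)
  case (coord D f i)
  then obtain E' where "E = Suc E'" "D \<le> E'" by (cases E) auto
  then show ?case using coord.IH by (auto intro: poly_fun.coord)
qed (auto intro: poly_fun.intros)

lemma poly_fun_0: "poly_fun D f \<Longrightarrow> D = 0 \<Longrightarrow> \<exists>c. f = (\<lambda>_. c)"
  by (induction rule: poly_fun.induct) auto

lemma poly_fun_scale: "poly_fun D f \<Longrightarrow> poly_fun D (\<lambda>x. c * f x)"
proof (induction rule: poly_fun.induct)
  case (const D d)
  then show ?case by (rule poly_fun.const)
next
  case (add D f g)
  then show ?case by (simp add: distrib_left poly_fun.add)
next
  case (coord D f i)
  from poly_fun.coord[OF coord.IH, of i] show ?case by (simp add: mult.left_commute)
qed

lemma poly_fun_mult: "poly_fun D f \<Longrightarrow> poly_fun E g \<Longrightarrow> poly_fun (D + E) (\<lambda>x. f x * g x)"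
proof (induction rule: poly_fun.induct)
  case (const D c)
  then show ?case by (auto intro: poly_fun_mono poly_fun_scale)
next
  case (add D f h)
  then show ?case by (simp add: distrib_right poly_fun.add)
next
  case (coord D f i)
  then show ?case using poly_fun.coord[of "D + E" "\<lambda>x. f x * g x" i] by (simp add: mult.assoc)
qed

lemma poly_fun_sum:
  assumes "finite I" "\<And>i. i \<in> I \<Longrightarrow> poly_fun D (f i)"
  shows "poly_fun D (\<lambda>x. \<Sum>i\<in>I. f i x)"
  using assms by (induction I rule: finite_induct) (auto intro: poly_fun.intros)

lemma poly_fun_prod:
  assumes "finite I" "\<And>i. i \<in> I \<Longrightarrow> poly_fun (D i) (f i)"
  shows "poly_fun (\<Sum>i\<in>I. D i) (\<lambda>x. \<Prod>i\<in>I. f i x)"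
  using assms by (induction I rule: finite_induct) (auto intro: poly_fun.intros poly_fun_mult)

lemma poly_fun_coord_power: "poly_fun k (\<lambda>x. (x $ i) ^ k)"
  by (induction k) (auto intro: poly_fun.intros)

text \<open>The clause for D = 0 carries the induction: multiplying a constant by a coordinate gives
  degree bound 1, and the term x $ k * F i x must then have degree bound 0, so \<open>F\<close> has
  to vanish.\<close>

lemma poly_fun_gradient:
  fixes f :: "real ^ 'n \<Rightarrow> real"
  assumes "poly_fun D f"
  shows "\<exists>G. (D = 0 \<longrightarrow> G = (\<lambda>i x. 0)) \<and> (\<forall>i. poly_fun (D - 1) (G i)) \<and>
    (\<forall>x. (f has_derivative (\<lambda>h. \<Sum>i\<in>UNIV. h $ i * G i x)) (at x))"
  using assms
proof (induction rule: poly_fun.induct)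
  case (const D c)
  show ?case by (rule exI[of _ "\<lambda>i x. 0"]) (auto intro: poly_fun.const)
next
  case (add D f g)
  then obtain F G where F: "D = 0 \<longrightarrow> F = (\<lambda>i x. 0)" "\<And>i. poly_fun (D - 1) (F i)"
      "\<And>x. (f has_derivative (\<lambda>h. \<Sum>i\<in>UNIV. h $ i * F i x)) (at x)"
    and G: "D = 0 \<longrightarrow> G = (\<lambda>i x. 0)" "\<And>i. poly_fun (D - 1) (G i)"
      "\<And>x. (g has_derivative (\<lambda>h. \<Sum>i\<in>UNIV. h $ i * G i x)) (at x)"
    by blast
  show ?case
  proof (rule exI[of _ "\<lambda>i x. F i x + G i x"], intro conjI allI impI)
    show "((\<lambda>x. f x + g x) has_derivative (\<lambda>h. \<Sum>i\<in>UNIV. h $ i * (F i x + G i x))) (at x)" for x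
      using has_derivative_add[OF F(3) G(3), of x] by (simp add: distrib_left sum.distrib)
  qed (use F G in \<open>auto intro: poly_fun.add\<close>)
next
  case (coord D f k)
  then obtain F where F: "D = 0 \<longrightarrow> F = (\<lambda>i x. 0)" "\<And>i. poly_fun (D - 1) (F i)"
      "\<And>x. (f has_derivative (\<lambda>h. \<Sum>i\<in>UNIV. h $ i * F i x)) (at x)"
    by blast
  show ?case
  proof (rule exI[of _ "\<lambda>i x. (if i = k then 1 else 0) * f x + x $ k * F i x"], intro conjI allI impI)
    fix i
    have "poly_fun D (\<lambda>x. x $ k * F i x)"
    proof (cases "D = 0")
      case True
      then show ?thesis using F(1) by (auto intro: poly_fun.const)
    next
      case False
      then show ?thesis using poly_fun.coord[OF F(2)[of i], of k] by simp
    qed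
    then show "poly_fun (Suc D - 1) (\<lambda>x. (if i = k then 1 else 0) * f x + x $ k * F i x)"
      using coord.hyps by (auto intro: poly_fun.add)
  next
    fix x :: "real ^ 'n"
    have "((\<lambda>x. x $ k) has_derivative (\<lambda>h. h $ k)) (at x)"
      by (rule bounded_linear_imp_has_derivative[OF bounded_linear_vec_nth])
    from has_derivative_mult[OF this F(3)]
    have deriv: "((\<lambda>x. x $ k * f x) has_derivative (\<lambda>h. x $ k * (\<Sum>i\<in>UNIV. h $ i * F i x) + h $ k * f x)) (at x)"
      by simp
    have eq: "x $ k * (\<Sum>i\<in>UNIV. h $ i * F i x) + h $ k * f x
        = (\<Sum>i\<in>UNIV. h $ i * ((if i = k then 1 else 0) * f x + x $ k * F i x))" for h
    proof -
      have "(\<Sum>i\<in>UNIV. h $ i * ((if i = k then 1 else 0) * f x)) = (\<Sum>i\<in>UNIV. if i = k then h $ i * f x else 0)"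
        by (rule sum.cong) auto
      also have "\<dots> = h $ k * f x" by simp
      finally show ?thesis
        by (simp add: distrib_left sum.distrib sum_distrib_left mult.left_commute)
    qed
    show "((\<lambda>x. x $ k * f x) has_derivative
        (\<lambda>h. \<Sum>i\<in>UNIV. h $ i * ((if i = k then 1 else 0) * f x + x $ k * F i x))) (at x)"
      by (rule has_derivative_eq_rhs[OF deriv]) (rule ext, rule eq)
  qed simp
qed

lemma poly_fun_continuous_on: "poly_fun D f \<Longrightarrow> continuous_on S f"
  by (induction rule: poly_fun.induct) (auto intro!: continuous_intros)

lemma poly_fun_line:
  assumes "poly_fun D f"
  obtains q where "degree q \<le> D" "\<And>t. f (x + t *\<^sub>R v) = poly q t"
proof -
  have "\<exists>q. degree q \<le> D \<and> (\<forall>t. f (x + t *\<^sub>R v) = poly q t)"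
    using assms
  proof (induction rule: poly_fun.induct)
    case (const D c)
    show ?case by (rule exI[of _ "[:c:]"]) auto
  next
    case (add D f g)
    then obtain p q where "degree p \<le> D" "\<forall>t. f (x + t *\<^sub>R v) = poly p t"
      "degree q \<le> D" "\<forall>t. g (x + t *\<^sub>R v) = poly q t" by blast
    then show ?case by (intro exI[of _ "p + q"]) (auto intro: degree_add_le)
  next
    case (coord D f i)
    then obtain p where p: "degree p \<le> D" "\<forall>t. f (x + t *\<^sub>R v) = poly p t" by blast
    have "degree ([:x $ i, v $ i:] * p) \<le> Suc D"
      by (rule order_trans[OF degree_mult_le]) (use p(1) in \<open>simp add: degree_pCons_eq_if\<close>)
    then show ?case using p(2) by (intro exI[of _ "[:x $ i, v $ i:] * p"]) (simp add: algebra_simps)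
  qed
  then show ?thesis using that by blast
qed

lemma poly_fun_line_zeros:
  assumes "poly_fun D f" "f (x + s *\<^sub>R v) \<noteq> 0"
  shows "finite {t. f (x + t *\<^sub>R v) = 0}" "card {t. f (x + t *\<^sub>R v) = 0} \<le> D"
proof -
  obtain q where q: "degree q \<le> D" "\<And>t. f (x + t *\<^sub>R v) = poly q t"
    by (rule poly_fun_line[OF assms(1), of x v]) blast
  then have "q \<noteq> 0" using assms(2) by auto
  then show "finite {t. f (x + t *\<^sub>R v) = 0}" "card {t. f (x + t *\<^sub>R v) = 0} \<le> D"
    using q poly_roots_finite[of q] card_poly_roots_bound[of q] by auto
qed

text \<open>On the curve x + t (y - x) the factor \<open>f\<close> is nonzero at t = 0 and
  \<open>g\<close> at t = 1, so each has finitely many zeros there and some parameter avoids them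
  all.\<close>

lemma poly_fun_mult_nonzero:
  assumes f: "poly_fun D f" "f x \<noteq> 0" and g: "poly_fun E g" "g y \<noteq> 0"
  obtains z where "f z * g z \<noteq> 0"
proof -
  let ?Z = "\<lambda>h. {t. h (x + t *\<^sub>R (y - x)) = 0}"
  have "finite (?Z f)" using f by (intro poly_fun_line_zeros(1)[of D f x 0]) auto
  moreover have "finite (?Z g)" using g by (intro poly_fun_line_zeros(1)[of E g x 1]) auto
  ultimately obtain t where "t \<notin> ?Z f \<union> ?Z g"
    using ex_new_if_finite[of "?Z f \<union> ?Z g"] infinite_UNIV_char_0 by blast
  then show ?thesis using that by auto
qed

text \<open>Monomials numbered by the base-\<open>B\<close> digits of their index, one digit per coordinate.
  On the curve with \<open>i\<close>-th coordinate \<open>t ^ (B ^ i)\<close> the monomial with index \<open>m\<close> is \<open>t ^ m\<close>.\<close>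

definition kronecker_monomial :: "nat \<Rightarrow> nat \<Rightarrow> real ^ 'n \<Rightarrow> real" where
  "kronecker_monomial B m x = (\<Prod>i\<in>UNIV. (x $ i) ^ (m div B ^ to_nat_on UNIV i mod B))"

lemma poly_fun_kronecker_monomial:
  "poly_fun (CARD('n) * (B - 1)) (kronecker_monomial B m :: real ^ 'n \<Rightarrow> real)" if "B > 0"
proof (rule poly_fun_mono)
  show "poly_fun (\<Sum>i\<in>(UNIV::'n set). m div B ^ to_nat_on UNIV i mod B) (kronecker_monomial B m :: real ^ 'n \<Rightarrow> real)"
    unfolding kronecker_monomial_def 
    by (rule poly_fun_prod[where f="\<lambda>i x. (x $ i) ^ (m div B ^ to_nat_on UNIV i mod B)"])
       (simp_all add: poly_fun_coord_power)
  have "(\<Sum>i\<in>(UNIV::'n set). m div B ^ to_nat_on UNIV i mod B) \<le> (\<Sum>i\<in>(UNIV::'n set). B - 1)"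
    using that by (intro sum_mono) (simp add: less_Suc_eq_le[symmetric])
  then show "(\<Sum>i\<in>(UNIV::'n set). m div B ^ to_nat_on UNIV i mod B) \<le> CARD('n) * (B - 1)"
    by simp
qed

lemma sum_digits_mod: "(\<Sum>i<n. (m div B ^ i mod B) * B ^ i) = m mod (B::nat) ^ n"
proof (induction n)
  case (Suc n)
  then show ?case using mod_mult2_eq[of m "B ^ n" B] by (simp add: mult.commute)
qed simp

lemma kronecker_monomial_curve:
  assumes "m < B ^ CARD('n)"
  shows "kronecker_monomial B m ((\<chi> i. t ^ (B ^ to_nat_on UNIV i)) :: real ^ 'n) = t ^ m"
proof -
  let ?i = "to_nat_on (UNIV :: 'n set)"
  have "bij_betw ?i UNIV {..<CARD('n)}" by (rule to_nat_on_finite) simp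
  then have "(\<Sum>i\<in>UNIV. (m div B ^ ?i i mod B) * B ^ ?i i) = (\<Sum>k<CARD('n). (m div B ^ k mod B) * B ^ k)"
    by (rule sum.reindex_bij_betw)
  also have "\<dots> = m" using assms by (simp add: sum_digits_mod)
  finally have "(\<Sum>i\<in>UNIV. B ^ ?i i * (m div B ^ ?i i mod B)) = m" by (simp add: mult.commute)
  then have "t ^ m = (\<Prod>i\<in>UNIV. t ^ (B ^ ?i i * (m div B ^ ?i i mod B)))"
    by (simp only: power_sum[symmetric])
  then show ?thesis by (simp add: kronecker_monomial_def power_mult)
qed

text \<open>Along the curve the combination becomes the univariate polynomial with coefficients
  \<open>c i\<close>.\<close>

lemma kronecker_monomials_independent:
  fixes c :: "nat \<Rightarrow> real"
  assumes "M < B ^ CARD('n)" "\<exists>i\<le>M. c i \<noteq> 0"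
  obtains x :: "real ^ 'n" where "(\<Sum>i\<le>M. c i * kronecker_monomial B i x) \<noteq> 0"
proof -
  define q where "q = (\<Sum>i\<le>M. Polynomial.monom (c i) i)"
  obtain k where k: "k \<le> M" "c k \<noteq> 0" using assms(2) by blast
  have "Polynomial.coeff q k = c k" using k(1) by (simp add: q_def coeff_sum)
  then have "q \<noteq> 0" using k(2) by auto
  then obtain t where t: "poly q t \<noteq> 0" using poly_all_0_iff_0 by blast
  let ?x = "(\<chi> i. t ^ (B ^ to_nat_on UNIV i)) :: real ^ 'n"
  have "(\<Sum>i\<le>M. c i * kronecker_monomial B i ?x) = poly q t"
    unfolding q_def poly_sum poly_monom using assms(1)
    by (intro sum.cong refl) (simp add: kronecker_monomial_curve)
  then show ?thesis using that[of ?x] t by simp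
qed

section \<open>Polynomial partitioning\<close>

text \<open>There are (e + 1) ^ d monomials with all exponents at most e, hence at least M + 1
  coefficients for bisecting M sets.\<close>

lemma polynomial_ham_sandwich:
  fixes A :: "nat \<Rightarrow> (real ^ 'd) set"
  assumes fin: "\<And>j. j < M \<Longrightarrow> finite (A j)" and M: "M < (e + 1) ^ CARD('d)"
  obtains f x where "poly_fun (CARD('d) * e) f" "f x \<noteq> 0"
    and "\<And>j. j < M \<Longrightarrow> 2 * card {p \<in> A j. f p > 0} \<le> card (A j)"
    and "\<And>j. j < M \<Longrightarrow> 2 * card {p \<in> A j. f p < 0} \<le> card (A j)"
proof -
  let ?b = "kronecker_monomial (e + 1) :: nat \<Rightarrow> real ^ 'd \<Rightarrow> real"
  show ?thesis
  proof (rule ham_sandwich_finite[of M A ?b])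
    show "finite (A j)" if "j < M" for j using fin[OF that] .
  next
    fix c
    assume c: "\<exists>i\<le>M. c i \<noteq> 0"
      and half: "\<And>j. j < M \<Longrightarrow> 2 * card {p \<in> A j. (\<Sum>i\<le>M. c i * ?b i p) > 0} \<le> card (A j)"
        "\<And>j. j < M \<Longrightarrow> 2 * card {p \<in> A j. (\<Sum>i\<le>M. c i * ?b i p) < 0} \<le> card (A j)"
    obtain x where x: "(\<Sum>i\<le>M. c i * ?b i x) \<noteq> 0"
      by (rule kronecker_monomials_independent[OF M c])
    have "poly_fun (CARD('d) * e) (?b i)" for i
      using poly_fun_kronecker_monomial[of "e + 1" i, where 'n='d] by simp
    then have "poly_fun (CARD('d) * e) (\<lambda>p. \<Sum>i\<le>M. c i * ?b i p)"
      by (intro poly_fun_sum[of "{..M}" _ "\<lambda>i p. c i * ?b i p"] poly_fun_scale) auto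
    then show ?thesis by (rule that[OF _ x half])
  qed
qed

lemma same_sign_on_segment:
  fixes f :: "real ^ 'd \<Rightarrow> real"
  assumes "poly_fun D f" "\<forall>z\<in>closed_segment x y. f z \<noteq> 0"
  shows "f x > 0 \<longleftrightarrow> f y > 0"
proof -
  have "connected (f ` closed_segment x y)"
    by (intro connected_continuous_image poly_fun_continuous_on[OF assms(1)] connected_segment)
  moreover have "f x \<in> f ` closed_segment x y" "f y \<in> f ` closed_segment x y" by auto
  moreover have "0 \<notin> f ` closed_segment x y" using assms(2) by auto
  ultimately show ?thesis
    using connectedD_interval[of "f ` closed_segment x y" "f x" "f y" 0]
      connectedD_interval[of "f ` closed_segment x y" "f y" "f x" 0] by linarith
qed

text \<open>Each round bisects all 2 ^ j classes by one new factor, whose sign is appended to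
  \<open>\<kappa>\<close> as a binary digit. The last clause holds because no factor changes sign
  along a segment on which the product has no zero.\<close>

lemma polynomial_partition:
  fixes P :: "(real ^ 'd) set"
  assumes "finite P"
  shows "\<exists>F x (\<kappa> :: real ^ 'd \<Rightarrow> nat). poly_fun (\<Sum>i<j. CARD('d) * 2 ^ (i div CARD('d) + 1)) F \<and> F x \<noteq> 0 \<and>
    (\<forall>x. \<kappa> x < 2 ^ j) \<and>
    (\<forall>i<2 ^ j. card {p \<in> P. F p \<noteq> 0 \<and> \<kappa> p = i} * 2 ^ j \<le> card P) \<and>
    (\<forall>x y. (\<forall>z\<in>closed_segment x y. F z \<noteq> 0) \<longrightarrow> \<kappa> x = \<kappa> y)"
proof (induction j)
  case 0
  show ?case
    by (rule exI[of _ "\<lambda>_. 1"], rule exI[of _ 0], rule exI[of _ "\<lambda>_. 0"]) (auto intro: poly_fun.const)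
next
  case (Suc j)
  let ?d = "CARD('d)"
  let ?S = "\<lambda>j. \<Sum>i<j. CARD('d) * 2 ^ (i div CARD('d) + 1)"
  from Suc obtain F x and \<kappa> :: "real ^ 'd \<Rightarrow> nat" where F: "poly_fun (?S j) F" "F x \<noteq> 0"
    and \<kappa>: "\<And>x. \<kappa> x < 2 ^ j" "\<And>i. i < 2 ^ j \<Longrightarrow> card {p \<in> P. F p \<noteq> 0 \<and> \<kappa> p = i} * 2 ^ j \<le> card P"
      "\<And>x y. \<forall>z\<in>closed_segment x y. F z \<noteq> 0 \<Longrightarrow> \<kappa> x = \<kappa> y"
    by blast
  define A where "A = (\<lambda>i. {p \<in> P. F p \<noteq> 0 \<and> \<kappa> p = i})"
  have finA: "finite (A i)" for i using assms by (simp add: A_def)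
  \<comment> \<open>This exponent bound makes (e + 1) ^ d exceed the number 2 ^ j of classes to be
    bisected.\<close>
  define e where "e = (2::nat) ^ (j div ?d + 1) - 1"
  have e1: "e + 1 = 2 ^ (j div ?d + 1)" by (simp add: e_def)
  have "j < ?d * (j div ?d + 1)"
    using dividend_less_times_div[of ?d j] by simp
  then have "(2::nat) ^ j < (e + 1) ^ ?d"
    unfolding e1 power_mult[symmetric] by (simp add: mult.commute)
  then obtain f y where f: "poly_fun (?d * e) f" "f y \<noteq> 0"
    and half: "\<And>i. i < 2 ^ j \<Longrightarrow> 2 * card {p \<in> A i. f p > 0} \<le> card (A i)"
      "\<And>i. i < 2 ^ j \<Longrightarrow> 2 * card {p \<in> A i. f p < 0} \<le> card (A i)"
    using polynomial_ham_sandwich[of "2 ^ j" A e] finA by blast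
  obtain z where z: "F z * f z \<noteq> 0" using poly_fun_mult_nonzero[OF F f] by blast
  let ?F = "\<lambda>x. F x * f x" and ?\<kappa> = "\<lambda>x. 2 * \<kappa> x + (if f x > 0 then 1 else 0)"
  show ?case
  proof (rule exI[of _ ?F], rule exI[of _ z], rule exI[of _ ?\<kappa>], intro conjI allI impI)
    have "e \<le> 2 ^ (j div ?d + 1)" by (simp add: e_def)
    then have "?S j + ?d * e \<le> ?S (Suc j)" by simp
    then show "poly_fun (?S (Suc j)) ?F" by (rule poly_fun_mono[OF poly_fun_mult[OF F(1) f(1)]])
    show "F z * f z \<noteq> 0" by (rule z)
    show "?\<kappa> x < 2 ^ Suc j" for x using \<kappa>(1)[of x] by auto
  next
    fix i :: nat assume "i < 2 ^ Suc j"
    then have i: "i div 2 < 2 ^ j" by auto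
    \<comment> \<open>Digit 0 means f p \<le> 0; off the zero set of the product this is f p < 0, so
      each new class lies in one open half of an old class.\<close>
    have "2 * card {p \<in> P. ?F p \<noteq> 0 \<and> ?\<kappa> p = i} \<le> card (A (i div 2))"
    proof (cases "even i")
      case True
      then have "{p \<in> P. ?F p \<noteq> 0 \<and> ?\<kappa> p = i} \<subseteq> {p \<in> A (i div 2). f p < 0}"
        by (auto simp: A_def)
      from card_mono[OF _ this] half(2)[OF i] show ?thesis using finA[of "i div 2"] by simp
    next
      case False
      then have "{p \<in> P. ?F p \<noteq> 0 \<and> ?\<kappa> p = i} \<subseteq> {p \<in> A (i div 2). f p > 0}"
        by (auto simp: A_def)
      from card_mono[OF _ this] half(1)[OF i] show ?thesis using finA[of "i div 2"] by simp
    qed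
    then have "2 * card {p \<in> P. ?F p \<noteq> 0 \<and> ?\<kappa> p = i} * 2 ^ j \<le> card (A (i div 2)) * 2 ^ j"
      by (rule mult_le_mono1)
    also have "\<dots> \<le> card P" using \<kappa>(2)[OF i] by (simp add: A_def)
    finally show "card {p \<in> P. ?F p \<noteq> 0 \<and> ?\<kappa> p = i} * 2 ^ Suc j \<le> card P"
      by (simp add: mult_ac)
  next
    fix x y assume "\<forall>z\<in>closed_segment x y. F z * f z \<noteq> 0"
    then have nz: "\<forall>z\<in>closed_segment x y. F z \<noteq> 0" "\<forall>z\<in>closed_segment x y. f z \<noteq> 0" by auto
    show "?\<kappa> x = ?\<kappa> y"
      using \<kappa>(3)[OF nz(1)] same_sign_on_segment[OF f(1) nz(2)] by simp
  qed
qed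

text \<open>The rounds come in blocks of \<open>d\<close> with equal degree bound, and the bounds of
  the blocks form a geometric series.\<close>

lemma sum_partition_degrees_le:
  assumes "d > 0"
  shows "(\<Sum>i<d * k. d * 2 ^ (i div d + 1)) \<le> d * d * (2::nat) ^ (k + 1)"
proof -
  have "(\<Sum>i<k * d. d * 2 ^ (i div d + 1)) = (\<Sum>m<k. \<Sum>i=m * d..<m * d + d. d * (2::nat) ^ (i div d + 1))"
    by (rule sum.nat_group[symmetric])
  also have "\<dots> = (\<Sum>m<k. \<Sum>i=m * d..<m * d + d. d * (2::nat) ^ (m + 1))"
  proof (intro sum.cong refl)
    fix m i assume "i \<in> {m * d..<m * d + d}"
    then have "i div d = m" using assms by (intro div_nat_eqI) (auto simp: mult.commute)
    then show "d * (2::nat) ^ (i div d + 1) = d * 2 ^ (m + 1)" by simp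
  qed
  also have "\<dots> = d * d * 2 * (\<Sum>m<k. (2::nat) ^ m)"
    by (simp add: sum_distrib_left mult_ac)
  also have "(\<Sum>m<k. (2::nat) ^ m) \<le> 2 ^ k" by (induction k) auto
  then have "d * d * 2 * (\<Sum>m<k. (2::nat) ^ m) \<le> d * d * 2 * 2 ^ k" by (rule mult_le_mono2)
  finally show ?thesis by (simp add: mult_ac)
qed

section \<open>Rich lines\<close>

lemma affine_line_eq_range:
  fixes l :: "(real ^ 'd) set"
  assumes "affine_line l" "a \<in> l" "b \<in> l" "a \<noteq> b"
  shows "l = range (\<lambda>t. a + t *\<^sub>R (b - a))"
proof -
  have l: "affine l" "aff_dim l = 1" using assms(1) by (auto simp: affine_line_def)
  have "affine hull {a, b} = l"
  proof (rule affine_dim_equal)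
    show "affine hull {a, b} \<subseteq> l" using assms l(1) by (intro hull_minimal) auto
    show "aff_dim (affine hull {a, b}) = aff_dim l" using assms(4) l(2) by (simp add: aff_dim_2)
  qed (use l in auto)
  then show ?thesis by (simp add: affine_hull_2_alt)
qed

lemma affine_line_param:
  fixes l :: "(real ^ 'd) set"
  assumes "affine_line l" "a \<in> l"
  obtains v where "v \<noteq> 0" "l = range (\<lambda>t. a + t *\<^sub>R v)"
proof -
  have "\<not> l \<subseteq> {a}"
    using assms(1) aff_dim_subset[of l "{a}"] by (auto simp: affine_line_def)
  then obtain b where "b \<in> l" "b \<noteq> a" by auto
  then show ?thesis
    using affine_line_eq_range[OF assms(1,2), of b] that[of "b - a"] by simp
qed

lemma affine_lines_eq:
  fixes l l' :: "(real ^ 'd) set"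
  assumes "affine_line l" "affine_line l'" "a \<in> l \<inter> l'" "b \<in> l \<inter> l'" "a \<noteq> b"
  shows "l = l'"
  using affine_line_eq_range[of l a b] affine_line_eq_range[of l' a b] assms by auto

lemma inj_line: "v \<noteq> 0 \<Longrightarrow> inj (\<lambda>t. a + t *\<^sub>R v :: real ^ 'd)"
  by (auto simp: inj_on_def)

lemma affine_line_zeros:
  fixes l :: "(real ^ 'd) set"
  assumes "affine_line l" "poly_fun D f" "x \<in> l" "f x \<noteq> 0"
  shows "finite {p \<in> l. f p = 0}" "card {p \<in> l. f p = 0} \<le> D"
proof -
  obtain v where v: "v \<noteq> 0" "l = range (\<lambda>t. x + t *\<^sub>R v)"
    using affine_line_param[OF assms(1,3)] by blast
  have fx: "f (x + 0 *\<^sub>R v) \<noteq> 0" using assms(4) by simp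
  have eq: "{p \<in> l. f p = 0} = (\<lambda>t. x + t *\<^sub>R v) ` {t. f (x + t *\<^sub>R v) = 0}"
    using v(2) by auto
  show "finite {p \<in> l. f p = 0}" "card {p \<in> l. f p = 0} \<le> D"
    unfolding eq using poly_fun_line_zeros[OF assms(2) fx]
    by (auto intro: order_trans[OF card_image_le])
qed

text \<open>On \<open>T\<close> the map \<open>g\<close> factors through \<open>N\<close>.\<close>

lemma card_image_le_factor:
  assumes "finite T" "\<And>s t. s \<in> T \<Longrightarrow> t \<in> T \<Longrightarrow> N s = N t \<Longrightarrow> g s = g t"
  shows "card (g ` T) \<le> card (N ` T)"
proof -
  have "g t = g (inv_into T N (N t))" if "t \<in> T" for t
    using assms(2)[OF that inv_into_into[of "N t" N T]] f_inv_into_f[of "N t" N T] that by simp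
  then have "g ` T \<subseteq> (\<lambda>n. g (inv_into T N n)) ` (N ` T)" by auto
  then show ?thesis using assms(1) by (meson finite_imageI surj_card_le)
qed

text \<open>The cell of a point on the line depends only on the number of zeros preceding it.\<close>

lemma card_cells_on_line:
  fixes \<kappa> :: "real ^ 'd \<Rightarrow> nat"
  assumes l: "affine_line l" and f: "poly_fun D f" and S: "finite S" "S \<subseteq> l" "\<forall>p\<in>S. f p \<noteq> 0"
    and \<kappa>: "\<And>x y. \<forall>z\<in>closed_segment x y. f z \<noteq> 0 \<Longrightarrow> \<kappa> x = \<kappa> y"
  shows "card (\<kappa> ` S) \<le> D + 1"
proof (cases "S = {}")
  case False
  then obtain x where x: "x \<in> S" by auto
  obtain v where v: "v \<noteq> 0" "l = range (\<lambda>t. x + t *\<^sub>R v)"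
    using affine_line_param[OF l] x S(2) by blast
  define \<gamma> where "\<gamma> = (\<lambda>t. x + t *\<^sub>R v)"
  define Z where "Z = {t. f (\<gamma> t) = 0}"
  have "f (x + 0 *\<^sub>R v) \<noteq> 0" using x S(3) by simp
  from poly_fun_line_zeros[OF f this] have Z: "finite Z" "card Z \<le> D" by (auto simp: Z_def \<gamma>_def)
  define T where "T = {t. \<gamma> t \<in> S}"
  have ST: "S = \<gamma> ` T" using S(2) v(2) by (auto simp: T_def \<gamma>_def)
  have "finite T"
    using inj_line[OF v(1), of x] S(1) finite_vimageI[of S \<gamma>] by (simp add: T_def vimage_def \<gamma>_def)
  define N where "N = (\<lambda>t. card {z \<in> Z. z < t})"
  have main: "\<kappa> (\<gamma> s) = \<kappa> (\<gamma> t)" if st: "s \<in> T" "t \<in> T" "N s = N t" "s < t" for s t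
  proof (rule \<kappa>, rule ballI)
    fix y assume "y \<in> closed_segment (\<gamma> s) (\<gamma> t)"
    then obtain u where u: "0 \<le> u" "u \<le> 1" "y = (1 - u) *\<^sub>R \<gamma> s + u *\<^sub>R \<gamma> t"
      by (auto simp: in_segment)
    define w where "w = (1 - u) * s + u * t"
    have yw: "y = \<gamma> w" by (simp add: u(3) w_def \<gamma>_def algebra_simps)
    have "w = s + u * (t - s)" "w = t - (1 - u) * (t - s)" by (simp_all add: w_def algebra_simps)
    moreover have "0 \<le> u * (t - s)" "0 \<le> (1 - u) * (t - s)" using u st(4) by simp_all
    ultimately have "s \<le> w" "w \<le> t" by linarith+
    have nz: "s \<notin> Z" "t \<notin> Z" using st S(3) by (auto simp: T_def Z_def)
    \<comment> \<open>One set contains the other and the counts agree, so no zero lies between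
      \<open>s\<close> and \<open>t\<close>. The counts range over 0 to D, whence at most D + 1
      cells.\<close>
    have "{z \<in> Z. z < s} = {z \<in> Z. z < t}"
      using st(3,4) Z(1) by (intro card_subset_eq) (auto simp: N_def)
    then have "w \<notin> Z" using \<open>s \<le> w\<close> \<open>w \<le> t\<close> nz by (metis (mono_tags, lifting) mem_Collect_eq not_less order_less_le)
    then show "f y \<noteq> 0" by (simp add: yw Z_def)
  qed
  have "\<kappa> ` S = (\<lambda>t. \<kappa> (\<gamma> t)) ` T" by (simp add: ST image_image)
  also have "card \<dots> \<le> card (N ` T)"
    using main by (intro card_image_le_factor \<open>finite T\<close>) (metis linorder_neqE_linordered_idom)
  also have "N ` T \<subseteq> {..D}"
    using Z by (auto simp: N_def intro: order_trans[OF card_mono])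
  then have "card (N ` T) \<le> D + 1" using card_mono[of "{..D}" "N ` T"] by simp
  finally show ?thesis .
qed simp

text \<open>Choose one representative per class; every other point forms a pair with its
  representative.\<close>

lemma card_same_class_pairs:
  assumes "finite S"
  shows "card S \<le> card (\<kappa> ` S) + card {(p, q). p \<in> S \<and> q \<in> S \<and> p \<noteq> q \<and> \<kappa> p = \<kappa> q}" (is "_ \<le> _ + card ?T")
proof -
  define R where "R = inv_into S \<kappa> ` \<kappa> ` S"
  have R: "R \<subseteq> S" by (auto simp: R_def inv_into_into)
  let ?h = "\<lambda>p. (inv_into S \<kappa> (\<kappa> p), p)"
  have "?h ` (S - R) \<subseteq> ?T"
  proof (rule image_subsetI)
    fix p assume p: "p \<in> S - R"
    then have "inv_into S \<kappa> (\<kappa> p) \<in> R" by (simp add: R_def)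
    with p R show "?h p \<in> ?T" by (auto simp: f_inv_into_f)
  qed
  moreover have "?T \<subseteq> S \<times> S" by auto
  then have "finite ?T" using assms by (simp add: finite_subset)
  ultimately have "card (?h ` (S - R)) \<le> card ?T" by (intro card_mono)
  moreover have "card (?h ` (S - R)) = card (S - R)" by (intro card_image) (auto simp: inj_on_def)
  moreover have "card (S - R) = card S - card R" using R assms by (intro card_Diff_subset) (auto intro: finite_subset)
  moreover have "card R \<le> card (\<kappa> ` S)" unfolding R_def using assms by (intro card_image_le) auto
  ultimately show ?thesis by linarith
qed

text \<open>Double counting of ordered pairs in a common cell. A line keeps at least r - D points
  off the zero set, spread over at most D + 1 cells, hence carries r - (2D + 1) pairs; distinct
  lines share none. Each point has at most card P / c partners.\<close>

lemma card_lines_not_vanishing: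
  fixes \<kappa> :: "real ^ 'd \<Rightarrow> nat"
  assumes P: "finite P" and L: "finite L" "\<And>l. l \<in> L \<Longrightarrow> affine_line l \<and> r \<le> card (l \<inter> P)"
    and f: "poly_fun D f" "\<And>l. l \<in> L \<Longrightarrow> \<exists>x\<in>l. f x \<noteq> 0"
    and \<kappa>: "\<And>x. \<kappa> x < m" "\<And>i. i < m \<Longrightarrow> card {p \<in> P. f p \<noteq> 0 \<and> \<kappa> p = i} * c \<le> card P"
      "\<And>x y. \<forall>z\<in>closed_segment x y. f z \<noteq> 0 \<Longrightarrow> \<kappa> x = \<kappa> y"
  shows "card L * (r - (2 * D + 1)) * c \<le> card P ^ 2"
proof -
  define P' where "P' = {p \<in> P. f p \<noteq> 0}"
  have P': "finite P'" using P by (simp add: P'_def)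
  define T where "T = (\<lambda>l. {(p, q). p \<in> l \<inter> P' \<and> q \<in> l \<inter> P' \<and> p \<noteq> q \<and> \<kappa> p = \<kappa> q})"
  define W where "W = {(p, q). p \<in> P' \<and> q \<in> P' \<and> \<kappa> p = \<kappa> q}"
  have finW: "finite W" by (rule finite_subset[of _ "P' \<times> P'"]) (use P' in \<open>auto simp: W_def\<close>)
  have TW: "T l \<subseteq> W" for l by (auto simp: T_def W_def)
  then have finT: "finite (T l)" for l using finW finite_subset by blast
  have big: "r - (2 * D + 1) \<le> card (T l)" if lL: "l \<in> L" for l
  proof -
    have l: "affine_line l" "r \<le> card (l \<inter> P)" using L(2)[OF lL] by auto
    obtain x where x: "x \<in> l" "f x \<noteq> 0" using f(2)[OF lL] by blast
    note Z = affine_line_zeros[OF l(1) f(1) x]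
    have "card (l \<inter> P) \<le> card ((l \<inter> P') \<union> {p \<in> l. f p = 0})"
      using P' Z(1) by (intro card_mono) (auto simp: P'_def)
    also have "\<dots> \<le> card (l \<inter> P') + card {p \<in> l. f p = 0}" by (rule card_Un_le)
    finally have "r \<le> card (l \<inter> P') + D" using l(2) Z(2) by linarith
    moreover have "card (l \<inter> P') \<le> card (\<kappa> ` (l \<inter> P')) + card (T l)"
      unfolding T_def by (rule card_same_class_pairs) (use P' in auto)
    moreover have "card (\<kappa> ` (l \<inter> P')) \<le> D + 1"
      using P' by (intro card_cells_on_line[OF l(1) f(1) _ _ _ \<kappa>(3)]) (auto simp: P'_def)
    ultimately show ?thesis by linarith
  qed
  have disj: "T l \<inter> T l' = {}" if "l \<in> L" "l' \<in> L" "l \<noteq> l'" for l l'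
    using affine_lines_eq[of l l'] L(2) that by (fastforce simp: T_def)
  have "card L * (r - (2 * D + 1)) \<le> (\<Sum>l\<in>L. card (T l))"
    using sum_mono[of L "\<lambda>_. r - (2 * D + 1)" "\<lambda>l. card (T l)"] big by simp
  also have "\<dots> = card (\<Union>l\<in>L. T l)"
    by (rule card_UN_disjoint[symmetric]) (use L(1) finT disj in auto)
  also have "\<dots> \<le> card W" using TW finW by (intro card_mono) auto
  also have "card W = (\<Sum>p\<in>P'. card {q \<in> P'. \<kappa> p = \<kappa> q})"
  proof -
    have "W = (SIGMA p:P'. {q \<in> P'. \<kappa> p = \<kappa> q})" by (auto simp: W_def)
    then show ?thesis using P' by simp
  qed
  finally have "card L * (r - (2 * D + 1)) * c \<le> (\<Sum>p\<in>P'. card {q \<in> P'. \<kappa> p = \<kappa> q} * c)"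
    unfolding sum_distrib_right[symmetric] by (rule mult_le_mono1)
  also have "\<dots> \<le> (\<Sum>p\<in>P'. card P)"
  proof (rule sum_mono)
    fix p
    have "{q \<in> P'. \<kappa> p = \<kappa> q} = {q \<in> P. f q \<noteq> 0 \<and> \<kappa> q = \<kappa> p}" by (auto simp: P'_def)
    then show "card {q \<in> P'. \<kappa> p = \<kappa> q} * c \<le> card P" using \<kappa>(2)[OF \<kappa>(1)[of p]] by simp
  qed
  also have "\<dots> \<le> card P * card P"
    using P by (simp add: P'_def card_mono)
  finally show ?thesis by (simp add: power2_eq_square)
qed

text \<open>Choose the subconfiguration maximizing the number of incidences minus \<open>\<alpha>\<close> per line minus \<open>\<beta>\<close> per point.\<close>

lemma rich_subconfiguration:
  fixes P :: "'a set" and L :: "'a set set" and \<alpha> \<beta> :: real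
  assumes P: "finite P" and L: "finite L" and \<beta>: "\<beta> \<ge> 0"
    and many: "\<alpha> * card L + \<beta> * card P < (\<Sum>l\<in>L. real (card (l \<inter> P)))"
  obtains P' L' where "P' \<subseteq> P" "L' \<subseteq> L" "L' \<noteq> {}"
    "\<And>l. l \<in> L' \<Longrightarrow> \<alpha> \<le> card (l \<inter> P')"
    "\<And>p. p \<in> P' \<Longrightarrow> \<beta> \<le> card {l \<in> L'. p \<in> l}"
proof -
  define W where "W = (\<lambda>(P' :: 'a set, L' :: 'a set set). (\<Sum>l\<in>L'. real (card (l \<inter> P'))) - \<alpha> * card L' - \<beta> * card P')"
  let ?S = "Pow P \<times> Pow L"
  have fin: "finite (W ` ?S)" and ne: "W ` ?S \<noteq> {}" using P L by auto
  obtain P' L' where PL: "P' \<subseteq> P" "L' \<subseteq> L" and max: "W (P', L') = Max (W ` ?S)"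
    using Max_in[OF fin ne] by (auto simp: image_iff)
  have le: "W (A, B) \<le> W (P', L')" if "A \<subseteq> P" "B \<subseteq> L" for A B
    unfolding max using fin that by (intro Max_ge) auto
  have fP: "finite P'" and fL: "finite L'" using PL P L finite_subset by auto
  have "0 < W (P, L)" using many by (simp add: W_def)
  then have pos: "0 < W (P', L')" using le[of P L] by simp
  show ?thesis
  proof (rule that[OF PL])
    \<comment> \<open>The maximal weight is positive because that of \<open>(P, L)\<close> is,
      whereas without lines the weight is at most 0.\<close>
    show "L' \<noteq> {}"
    proof
      assume "L' = {}"
      then have "W (P', L') \<le> 0" using \<beta> by (simp add: W_def)
      with pos show False by simp
    qed
  next
    \<comment> \<open>Deleting \<open>l\<close> changes the weight by \<alpha> minus the number of
      its points, which maximality keeps from being positive. The argument for points is the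
      same.\<close>
    fix l assume l: "l \<in> L'"
    then have "card L' \<ge> 1" using fL by (auto simp: Suc_le_eq card_gt_0_iff)
    then have "\<alpha> * real (card (L' - {l})) = \<alpha> * real (card L') - \<alpha>"
      using l fL by (simp add: of_nat_diff right_diff_distrib)
    moreover have "(\<Sum>l\<in>L'. real (card (l \<inter> P'))) = real (card (l \<inter> P')) + (\<Sum>l\<in>L' - {l}. real (card (l \<inter> P')))"
      by (rule sum.remove[OF fL l])
    moreover have "W (P', L' - {l}) \<le> W (P', L')" using PL by (intro le) auto
    ultimately show "\<alpha> \<le> card (l \<inter> P')" by (simp add: W_def)
  next
    fix p assume p: "p \<in> P'"
    then have "card P' \<ge> 1" using fP by (auto simp: Suc_le_eq card_gt_0_iff)
    then have cP: "\<beta> * real (card (P' - {p})) = \<beta> * real (card P') - \<beta>"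
      using p fP by (simp add: of_nat_diff right_diff_distrib)
    have "real (card (l \<inter> P')) = real (card (l \<inter> (P' - {p}))) + (if p \<in> l then 1 else 0)" for l
    proof (cases "p \<in> l")
      case True
      then have "l \<inter> P' = insert p (l \<inter> (P' - {p}))" using p by auto
      then have "card (l \<inter> P') = Suc (card (l \<inter> (P' - {p})))"
        by (metis Diff_iff IntD2 card_insert_disjoint fP finite_Diff finite_Int insertI1)
      then show ?thesis using True by simp
    next
      case False
      then have "l \<inter> P' = l \<inter> (P' - {p})" by auto
      then show ?thesis using False by simp
    qed
    then have "(\<Sum>l\<in>L'. real (card (l \<inter> P'))) =
        (\<Sum>l\<in>L'. real (card (l \<inter> (P' - {p})))) + (\<Sum>l\<in>L'. if p \<in> l then 1 else 0)"
      by (simp add: sum.distrib)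
    moreover have "(\<Sum>l\<in>L'. if p \<in> l then 1 else 0 :: real) = card {l \<in> L'. p \<in> l}"
      using fL by (simp add: sum.If_cases Int_def)
    moreover have "W (P' - {p}, L') \<le> W (P', L')" using PL by (intro le) auto
    ultimately show "\<beta> \<le> card {l \<in> L'. p \<in> l}" using cP by (simp add: W_def)
  qed
qed

section \<open>The gradient of a vanishing polynomial of least degree\<close>

lemma affine_line_nonempty: "affine_line l \<Longrightarrow> l \<noteq> {}"
  by (auto simp: affine_line_def)

lemma hyperplane_normal:
  fixes w :: "real ^ 'd"
  assumes "w \<noteq> 0"
  shows "hyperplane {x. w \<bullet> x = b}"
  using assms by (simp add: hyperplane_def affine_hyperplane aff_dim_hyperplane)

text \<open>Take a nonzero polynomial of least degree vanishing on all the lines.  Some partial derivative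
  does not vanish on some line, hence not at some point \<open>p\<close> of \<open>P\<close> on it, and then all lines through
  \<open>p\<close> are orthogonal to the gradient at \<open>p\<close>.\<close>

lemma lines_through_point_in_hyperplane:
  fixes L :: "(real ^ 'd) set set"
  assumes L: "L \<noteq> {}" "\<And>l. l \<in> L \<Longrightarrow> affine_line l" "\<And>l. l \<in> L \<Longrightarrow> D \<le> card (l \<inter> P)"
    and f: "poly_fun D f" "f x \<noteq> 0" "\<And>l y. l \<in> L \<Longrightarrow> y \<in> l \<Longrightarrow> f y = 0"
  obtains p H where "p \<in> P" "hyperplane H" "\<And>l. l \<in> L \<Longrightarrow> p \<in> l \<Longrightarrow> l \<subseteq> H"
proof -
  define good where "good = (\<lambda>m. \<exists>g. poly_fun m g \<and> (\<exists>x. g x \<noteq> 0) \<and> (\<forall>l\<in>L. \<forall>y\<in>l. g (y :: real ^ 'd) = 0))"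
  have "good D" using f by (auto simp: good_def)
  define m where "m = (LEAST m. good m)"
  have "good m" unfolding m_def by (rule LeastI) fact
  have "m \<le> D" unfolding m_def by (rule Least_le) fact
  have minimal: "\<not> good k" if "k < m" for k using not_less_Least that by (auto simp: m_def)
  obtain g x0 where g: "poly_fun m g" "g x0 \<noteq> 0" "\<And>l y. l \<in> L \<Longrightarrow> y \<in> l \<Longrightarrow> g y = 0"
    using \<open>good m\<close> by (auto simp: good_def)
  obtain l0 where l0: "l0 \<in> L" using L(1) by auto
  obtain y0 where y0: "y0 \<in> l0"
    using affine_line_nonempty[OF L(2)[OF l0]] by auto
  have gy0: "g y0 = 0" by (rule g(3)[OF l0 y0])
  have "m \<noteq> 0"
  proof
    assume "m = 0"
    then obtain c where "g = (\<lambda>_. c)" using poly_fun_0[OF g(1)] by blast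
    then show False using g(2) gy0 by simp
  qed
  obtain G where G: "\<And>i. poly_fun (m - 1) (G i)"
    and deriv: "\<And>x. (g has_derivative (\<lambda>h. \<Sum>i\<in>UNIV. h $ i * G i x)) (at x)"
    using poly_fun_gradient[OF g(1)] by (elim exE conjE) (rule that, erule spec, erule spec)
  \<comment> \<open>If every partial derivative vanished on all lines, minimality of m would make
    each identically zero and \<open>g\<close> constant, although \<open>g\<close> is zero at y0 but
    not at x0.\<close>
  have "\<exists>i. \<exists>l\<in>L. \<exists>y\<in>l. G i y \<noteq> 0"
  proof (rule ccontr)
    assume none: "\<not> ?thesis"
    have "G i x = 0" for i x
    proof (rule ccontr)
      assume "G i x \<noteq> 0"
      then have "good (m - 1)" unfolding good_def using G[of i] none by (intro exI[of _ "G i"]) auto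
      then show False using minimal[of "m - 1"] \<open>m \<noteq> 0\<close> by simp
    qed
    then have "(g has_derivative (\<lambda>h. 0)) (at x)" for x using deriv[of x] by simp
    then have "g x0 = g y0"
      by (intro has_derivative_zero_unique[of UNIV g]) auto
    then show False using g(2) gy0 by simp
  qed
  then obtain i l y where l: "l \<in> L" "y \<in> l" "G i y \<noteq> 0" by blast
  note Z = affine_line_zeros[OF L(2)[OF l(1)] G l(2,3)]
  \<comment> \<open>The partial derivative has at most m - 1 < D zeros on \<open>l\<close>, which
    carries at least D points of \<open>P\<close>.\<close>
  have "\<exists>p\<in>l \<inter> P. G i p \<noteq> 0"
  proof (rule ccontr)
    assume "\<not> ?thesis"
    then have "l \<inter> P \<subseteq> {p \<in> l. G i p = 0}" by auto
    then have "card (l \<inter> P) \<le> m - 1" using card_mono[OF Z(1)] Z(2) by (meson order_trans)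
    then show False using L(3)[OF l(1)] \<open>m \<le> D\<close> \<open>m \<noteq> 0\<close> by linarith
  qed
  then obtain p where p: "p \<in> l" "p \<in> P" "G i p \<noteq> 0" by auto
  define w where "w = (\<chi> i. G i p)"
  have "w \<noteq> 0" using p(3) by (auto simp: w_def vec_eq_iff)
  show ?thesis
  proof (rule that[OF p(2) hyperplane_normal[OF \<open>w \<noteq> 0\<close>]])
    fix l assume l: "l \<in> L" "p \<in> l"
    obtain v where v: "l = range (\<lambda>t. p + t *\<^sub>R v)" using affine_line_param[OF L(2)[OF l(1)] l(2)] by blast
    have "((\<lambda>t. p + t *\<^sub>R v) has_derivative (\<lambda>t. t *\<^sub>R v)) (at 0)"
      by (auto intro!: derivative_eq_intros)
    from has_derivative_compose[OF this, of g "\<lambda>h. \<Sum>i\<in>UNIV. h $ i * G i p"]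
    have "((\<lambda>t. g (p + t *\<^sub>R v)) has_derivative (\<lambda>t. \<Sum>i\<in>UNIV. (t *\<^sub>R v) $ i * G i p)) (at 0)"
      using deriv[of p] by simp
    moreover have "(\<lambda>t. g (p + t *\<^sub>R v)) = (\<lambda>t. 0)" using g(3)[OF l(1)] v by auto
    ultimately have "((\<lambda>t. 0 :: real) has_derivative (\<lambda>t. \<Sum>i\<in>UNIV. (t *\<^sub>R v) $ i * G i p)) (at 0)"
      by simp
    then have "(\<lambda>t :: real. \<Sum>i\<in>UNIV. (t *\<^sub>R v) $ i * G i p) = (\<lambda>t. 0)"
      using has_derivative_unique has_derivative_const by blast
    from fun_cong[OF this, of 1] have "w \<bullet> v = 0"
      by (simp add: inner_vec_def w_def mult.commute)
    then show "l \<subseteq> {x. w \<bullet> x = w \<bullet> p}" by (auto simp: v inner_add_right)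
  qed
qed

section \<open>Counting along rich lines and choosing the constants\<close>

lemma finite_rich_lines:
  fixes P :: "(real ^ 'd) set"
  assumes "finite P" "r \<ge> 2" "\<And>l. l \<in> L \<Longrightarrow> affine_line l \<and> r \<le> card (l \<inter> P)"
  shows "finite L"
proof (rule inj_on_finite[of "\<lambda>l. l \<inter> P" L "Pow P"])
  show "inj_on (\<lambda>l. l \<inter> P) L"
  proof (rule inj_onI)
    fix l l' assume l: "l \<in> L" "l' \<in> L" "l \<inter> P = l' \<inter> P"
    \<comment> \<open>Two points determine a line, so \<open>l\<close> is recovered from its trace
      on \<open>P\<close>.\<close>
    have "2 \<le> card (l \<inter> P)" using assms(2) assms(3)[OF l(1)] by linarith
    then obtain T where "T \<subseteq> l \<inter> P" "card T = 2" by (meson obtain_subset_with_card_n)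
    then obtain a b where "a \<in> l \<inter> P" "b \<in> l \<inter> P" "a \<noteq> b" by (auto simp: card_2_iff)
    then show "l = l'" using affine_lines_eq[of l l' a b] assms(3) l by auto
  qed
qed (use assms in auto)

text \<open>The lines meet pairwise only in \<open>p\<close>, so their other points of
  \<open>P\<close> form disjoint sets.\<close>

lemma card_union_lines_through_point:
  fixes P :: "(real ^ 'd) set"
  assumes "finite P" "finite M"
    "\<And>l. l \<in> M \<Longrightarrow> affine_line l \<and> r \<le> card (l \<inter> P) \<and> p \<in> l \<and> l \<subseteq> H"
  shows "card M * (r - 1) \<le> card (H \<inter> P)"
proof -
  have disj: "(l \<inter> P - {p}) \<inter> (l' \<inter> P - {p}) = {}" if "l \<in> M" "l' \<in> M" "l \<noteq> l'" for l l'
    using affine_lines_eq[of l l' p] assms(3) that by blast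
  have "r - 1 \<le> card (l \<inter> P - {p})" if "l \<in> M" for l
  proof -
    have "card (l \<inter> P) - 1 \<le> card (l \<inter> P - {p})"
      using diff_card_le_card_Diff[of "{p}" "l \<inter> P"] by simp
    moreover have "r \<le> card (l \<inter> P)" using assms(3)[OF that] by blast
    ultimately show ?thesis by linarith
  qed
  then have "card M * (r - 1) \<le> (\<Sum>l\<in>M. card (l \<inter> P - {p}))"
    using sum_mono[of M "\<lambda>_. r - 1" "\<lambda>l. card (l \<inter> P - {p})"] by simp
  also have "\<dots> = card (\<Union>l\<in>M. l \<inter> P - {p})"
    by (rule card_UN_disjoint[symmetric]) (use assms(1,2) disj in auto)
  also have "\<dots> \<le> card (H \<inter> P)"
    using assms(1,3) by (intro card_mono) auto
  finally show ?thesis .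
qed

lemma dyadic_scale:
  fixes c r :: nat
  assumes "0 < c" "c \<le> r"
  obtains k where "c * 2 ^ k \<le> r" "r < c * 2 ^ (k + 1)"
proof -
  define m where "m = (LEAST m. r < c * 2 ^ m)"
  have "r < 2 ^ r" by simp
  also have "\<dots> \<le> c * 2 ^ r" using assms(1) by simp
  finally have ex: "r < c * 2 ^ r" .
  have m: "r < c * 2 ^ m" unfolding m_def by (rule LeastI, rule ex)
  then have "m \<noteq> 0" using assms by (cases "m = 0") auto
  then obtain k where k: "m = Suc k" by (cases m) auto
  then have "\<not> r < c * 2 ^ k" using not_less_Least[of k "\<lambda>m. r < c * 2 ^ m"] by (simp add: m_def)
  then show ?thesis using m k that[of k] by simp
qed

theorem theorem2p2:
  shows "\<exists>K N :: real. K > 0 \<and> N > 0 \<and>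
    (\<forall>(P :: (real ^ 'd) set) (L :: (real ^ 'd) set set) (n :: nat) (r :: nat).
      finite P \<longrightarrow> card P = n \<longrightarrow> r \<ge> 2 \<longrightarrow>
      (\<forall>l\<in>L. affine_line l \<and> card (l \<inter> P) \<ge> r) \<longrightarrow>
      real (card L) \<ge> K * (real n ^ 2 / real r ^ (CARD('d) + 1)) \<longrightarrow>
      (\<exists>H. hyperplane H \<and>
        real (card (H \<inter> P)) \<ge> N * (real n / real r ^ (CARD('d) - 1))))"
proof -
  define d where "d = CARD('d)"
  have d: "d > 0" by (simp add: d_def)
  \<comment> \<open>Twice the threshold 16 d^2, so that the dyadic scale k below satisfies r < c * 2
    ^ k.\<close>
  define c where "c = 32 * d\<^sup>2"
  have c: "c \<ge> 32" "c > 0" using d by (simp_all add: c_def)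
  \<comment> \<open>Lines off the zero set number at most 4 c ^ d X with X = n^2 / r ^ (d+1), so at
    least 4 c ^ (d+1) X lines remain on it.\<close>
  define K where "K = 8 * real c ^ (d + 1)"
  have K: "K > 0" using c by (simp add: K_def)
  have main: "\<exists>H. hyperplane H \<and> real (card (H \<inter> P)) \<ge> 1 * (real n / real r ^ (d - 1))"
    if P: "finite P" "card P = n" and r: "r \<ge> 2"
      and rich: "\<forall>l\<in>L. affine_line l \<and> card (l \<inter> P) \<ge> r"
      and big: "real (card L) \<ge> K * (real n ^ 2 / real r ^ (d + 1))"
    for P :: "(real ^ 'd) set" and L n r
  proof (cases "n = 0")
    case True
    have "hyperplane {x :: real ^ 'd. axis undefined 1 \<bullet> x = 0}" by (rule hyperplane_normal) (simp add: axis_eq_0_iff)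
    then show ?thesis using True by (intro exI) auto
  next
    case False
    have rL: "affine_line l \<and> r \<le> card (l \<inter> P)" if "l \<in> L" for l using rich that by blast
    have fL: "finite L" by (rule finite_rich_lines[OF P(1) r rL])
    define X where "X = real n ^ 2 / real r ^ (d + 1)"
    have X: "X > 0" using False r by (simp add: X_def)
    have rd: "real r ^ (d + 1) > 0" using r by simp
    \<comment> \<open>For smaller r the hypothesis would give more than n^2 lines. Pair counting
      with the constant polynomial 1 and a single cell allows at most n^2.\<close>
    have "16 * d\<^sup>2 \<le> r"
    proof (rule ccontr)
      assume "\<not> 16 * d\<^sup>2 \<le> r"
      then have "r \<le> c" by (simp add: c_def)
      then have "real r \<le> real c" by simp
      then have "real r ^ (d + 1) \<le> real c ^ (d + 1)" by (intro power_mono) auto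
      also have "\<dots> < K" using c by (simp add: K_def)
      finally have "real r ^ (d + 1) * X < K * X" using X by simp
      also have "real r ^ (d + 1) * X = real n ^ 2" using r by (simp add: X_def)
      finally have "real n ^ 2 < real (card L)" using big unfolding X_def by linarith
      then have "real (n ^ 2) < real (card L)" by simp
      then have "n ^ 2 < card L" by (simp only: of_nat_less_iff)
      have "card L * (r - (2 * 0 + 1)) * 1 \<le> card P ^ 2"
        by (rule card_lines_not_vanishing[OF P(1) fL rL poly_fun.const[of 0 1], where \<kappa>="\<lambda>_. 0" and m=1])
           (use rL affine_line_nonempty P(1) in \<open>auto simp: ex_in_conv\<close>)
      then have "card L * (r - 1) \<le> n ^ 2" using P(2) by simp
      moreover have "card L * 1 \<le> card L * (r - 1)" using r by (intro mult_le_mono2) simp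
      ultimately have "card L \<le> n ^ 2" by linarith
      with \<open>n ^ 2 < card L\<close> show False by simp
    qed
    then obtain k where k: "16 * d\<^sup>2 * 2 ^ k \<le> r" "r < 16 * d\<^sup>2 * 2 ^ (k + 1)"
      using dyadic_scale[of "16 * d\<^sup>2" r] d by auto
    \<comment> \<open>The degree bound for d * k rounds of bisection; 8 * D equals 16 d^2 2 ^ k,
      which is at most r.\<close>
    define D where "D = d * d * (2::nat) ^ (k + 1)"
    have D: "8 * D \<le> r" using k(1) by (simp add: D_def power2_eq_square)
    obtain F x and \<kappa> :: "real ^ 'd \<Rightarrow> nat" where F: "poly_fun (\<Sum>i<d * k. d * 2 ^ (i div d + 1)) F" "F x \<noteq> 0"
      and \<kappa>: "\<And>x. \<kappa> x < 2 ^ (d * k)" "\<And>i. i < 2 ^ (d * k) \<Longrightarrow> card {p \<in> P. F p \<noteq> 0 \<and> \<kappa> p = i} * 2 ^ (d * k) \<le> card P"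
        "\<And>x y. \<forall>z\<in>closed_segment x y. F z \<noteq> 0 \<Longrightarrow> \<kappa> x = \<kappa> y"
      using polynomial_partition[OF P(1), of "d * k"] unfolding d_def by blast
    have FD: "poly_fun D F"
      by (rule poly_fun_mono[OF F(1)]) (simp only: D_def sum_partition_degrees_le[OF d])
    define Loff where "Loff = {l \<in> L. \<exists>x\<in>l. F x \<noteq> 0}"
    define Lon where "Lon = {l \<in> L. \<forall>x\<in>l. F x = 0}"
    have fin: "finite Loff" "finite Lon" using fL by (auto simp: Loff_def Lon_def)
    have "L = Loff \<union> Lon" "Loff \<inter> Lon = {}" by (auto simp: Loff_def Lon_def)
    then have cL: "card L = card Loff + card Lon" using fin by (simp add: card_Un_disjoint)
    have "card Loff * (r - (2 * D + 1)) * 2 ^ (d * k) \<le> card P ^ 2"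
      by (rule card_lines_not_vanishing[OF P(1) fin(1) _ FD _ \<kappa>]) (use rL in \<open>auto simp: Loff_def\<close>)
    then have "real (card Loff * (r - (2 * D + 1)) * 2 ^ (d * k)) \<le> real (n ^ 2)"
      unfolding P(2) by (simp only: of_nat_le_iff)
    then have off: "real (card Loff) * real (r - (2 * D + 1)) * 2 ^ (d * k) \<le> real n ^ 2" by simp
    \<comment> \<open>From 8 * D \<le> r the left-over is at least 3r/4 - 1, and r \<ge> 2 makes
      this at least r/4.\<close>
    have r4: "real r / 4 \<le> real (r - (2 * D + 1))" using D r by linarith
    have "real r < real (c * 2 ^ k)" using k(2) unfolding of_nat_less_iff by (simp add: c_def)
    then have "(real r / real c) ^ d \<le> (2 ^ k) ^ d"
      using c by (intro power_mono) (simp_all add: field_simps)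
    then have rk: "real r ^ d / real c ^ d \<le> 2 ^ (d * k)"
      by (simp add: power_divide power_mult[symmetric] mult.commute)
    have "real (card Loff) * (real r / 4) * (real r ^ d / real c ^ d)
        \<le> real (card Loff) * real (r - (2 * D + 1)) * 2 ^ (d * k)"
      by (intro mult_mono rk r4) auto
    also note off
    finally have "real (card Loff) \<le> 4 * real c ^ d * X"
      using rd c by (simp add: X_def field_simps)
    also have "\<dots> \<le> 4 * real c ^ (d + 1) * X" using c X by simp
    finally have on: "real (card Lon) \<ge> 4 * real c ^ (d + 1) * X"
      using big cL by (simp add: K_def X_def)
    have "4 * real c ^ (d + 1) * X > 0" using X c by simp
    with on have on0: "real (card Lon) > 0" by linarith
    \<comment> \<open>The lines guarantee card Lon * r incidences; the penalties r/4 per line and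
      \<beta> per point each use up a quarter of that.\<close>
    define \<beta> where "\<beta> = real (card Lon) * real r / (4 * real n)"
    have \<beta>: "\<beta> \<ge> 0" by (simp add: \<beta>_def)
    have "real r / 4 * card Lon + \<beta> * card P < (\<Sum>l\<in>Lon. real (card (l \<inter> P)))"
    proof -
      have "real r / 4 * card Lon + \<beta> * card P = real (card Lon) * real r / 2"
        using False P(2) by (simp add: \<beta>_def)
      also have "\<dots> < real (card Lon) * real r" using on0 r by simp
      also have "\<dots> = (\<Sum>l\<in>Lon. real r)" by simp
      also have "\<dots> \<le> (\<Sum>l\<in>Lon. real (card (l \<inter> P)))"
        by (rule sum_mono) (use rL in \<open>auto simp: Lon_def\<close>)
      finally show ?thesis .
    qed
    from rich_subconfiguration[OF P(1) fin(2) \<beta> this]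
    obtain P' L' where PL: "P' \<subseteq> P" "L' \<subseteq> Lon" "L' \<noteq> {}"
      and rich_l: "\<And>l. l \<in> L' \<Longrightarrow> real r / 4 \<le> card (l \<inter> P')"
      and rich_p: "\<And>p. p \<in> P' \<Longrightarrow> \<beta> \<le> card {l \<in> L'. p \<in> l}" by blast
    \<comment> \<open>Pruned lines still carry r/4 \<ge> D points of \<open>P'\<close>, and
      \<open>F\<close> vanishes on all of them.\<close>
    obtain p H where p: "p \<in> P'" and H: "hyperplane H" "\<And>l. l \<in> L' \<Longrightarrow> p \<in> l \<Longrightarrow> l \<subseteq> H"
    proof (rule lines_through_point_in_hyperplane[of L' D P' F x])
      show "D \<le> card (l \<inter> P')" if "l \<in> L'" for l using rich_l[OF that] D by linarith
    qed (use PL rL FD F(2) in \<open>auto simp: Lon_def\<close>)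
    let ?M = "{l \<in> L'. p \<in> l}"
    have "card ?M * (r - 1) \<le> card (H \<inter> P)"
    proof (rule card_union_lines_through_point[OF P(1)])
      show "finite ?M" using PL(2) fin(2) by (auto intro: finite_subset)
    qed (use PL(2) H(2) rL in \<open>auto simp: Lon_def\<close>)
    then have "real (card ?M * (r - 1)) \<le> real (card (H \<inter> P))" by (simp only: of_nat_le_iff)
    then have "real (card ?M) * real (r - 1) \<le> real (card (H \<inter> P))" by simp
    moreover have "\<beta> * (real r / 2) \<le> real (card ?M) * real (r - 1)"
      using r by (intro mult_mono rich_p[OF p] \<beta>) auto
    \<comment> \<open>Inserting the lower bound for \<open>card Lon\<close> into \<beta> gives c ^
      (d+1) / 2 times the desired quantity, which is why N = 1 suffices.\<close>
    moreover have "real n / real r ^ (d - 1) \<le> \<beta> * (real r / 2)"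
    proof -
      have rr: "real r ^ (d + 1) = real r ^ (d - 1) * real r ^ 2"
        using d by (simp flip: power_add)
      have "real c \<le> real c ^ (d + 1)" using c by (intro self_le_power) auto
      then have "1 \<le> real c ^ (d + 1) / 2" using c by linarith
      then have "1 * (real n / real r ^ (d - 1)) \<le> real c ^ (d + 1) / 2 * (real n / real r ^ (d - 1))"
        by (intro mult_right_mono) auto
      also have "\<dots> = 4 * real c ^ (d + 1) * X * real r / (4 * real n) * (real r / 2)"
        using False r unfolding X_def rr by (simp add: field_simps power2_eq_square)
      also have "\<dots> \<le> \<beta> * (real r / 2)"
        unfolding \<beta>_def using on by (intro mult_right_mono divide_right_mono) auto
      finally show ?thesis by simp
    qed
    ultimately have "real n / real r ^ (d - 1) \<le> real (card (H \<inter> P))" by linarith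
    then show ?thesis using H(1) by auto
  qed
  show ?thesis
    by (rule exI[of _ K], rule exI[of _ 1], intro conjI allI impI K zero_less_one)
       (rule main[unfolded d_def]; assumption)
qed

end
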